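(* Let $F$ be a fixed graph and let $e\in E(F)$. Let $\mathcal{H}$ be a Berge-$F$-free hypergraph on $n$ vertices such that every edge of $\mathcal{H}$ has size at least $R(F, F \setminus e)$ and at most $o(n)$. Then \[ \sum_{h \in E(\mathcal{H})} |h|^2 = o(n^2). \] That is, for every graph $F$, every $e \in E(F)$ and every function $g$ with $g(n)=o(n)$ as $n\to\infty$, for every $\varepsilon>0$ there is $n_0$ such that for all $n\ge n_0$, every Berge-$F$-free hypergraph $\mathcal{H}$ on $n$ vertices with $R(F,F\setminus e)\le |h|\le g(n)$ for all $h\in E(\mathcal{H})$ satisfies $\sum_{h \in E(\mathcal{H})} |h|^2 \le \varepsilon n^2$.
   Context: Graphs are finite and simple. Hypergraphs are finite, not necessarily uniform, and have no repeated hyperedges: $E(\mathcal{H})$ is a set of subsets of the vertex set $V(\mathcal{H})$; $|h|$ denotes the number of vertices of a hyperedge $h$. Given a graph $F$, a hypergraph $\mathcal{H}$ is called Berge-$F$ if there is a bijection $f:E(F)\to E(\mathcal{H})$ such that $e\subseteq f(e)$ for every $e\in E(F)$, where the vertices of $F$ are identified with distinct vertices of $\mathcal{H}$. Equivalently, one can embed a distinct graph edge into each hyperedge of $\mathcal{H}$ so as to obtain a copy of $F$. A hypergraph is Berge-$F$-free if it contains no subhypergraph that is Berge-$F$ (for any such identification of the vertices of $F$ with vertices of the hypergraph). For $e\in E(F)$, $F\setminus e$ denotes the graph with $V(F\setminus e)=V(F)$ and $E(F\setminus e)=E(F)\setminus\{e\}$. For graphs $F$ and $G$, $R(F,G)$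 denotes the 2-color Ramsey number: the smallest $N$ such that every coloring of the edges of the complete graph $K_N$ with two colors contains a (not necessarily induced) copy of $F$ all of whose edges have the first color or a copy of $G$ all of whose edges have the second color. *)

theory Defs
  imports Complex_Main "HOL-Library.Ramsey" "HOL-Library.Landau_Symbols"
begin

type_synonym 'a hgraph = "'a set \<times> 'a set set"

abbreviation verts :: "'a hgraph \<Rightarrow> 'a set" where
  "verts \<equiv> fst"

abbreviation edges :: "'a hgraph \<Rightarrow> 'a set set" where
  "edges \<equiv> snd"

definition hypergraph :: "'a hgraph \<Rightarrow> bool" where
  "hypergraph H \<longleftrightarrow> finite (verts H) \<and> edges H \<subseteq> Pow (verts H)"

definition graph :: "'a hgraph \<Rightarrow> bool" where
  "graph F \<longleftrightarrow> finite (verts F) \<and> edges F \<subseteq> [verts F]\<^bsup>2\<^esup>"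

definition del_edge :: "'a hgraph \<Rightarrow> 'a set \<Rightarrow> 'a hgraph" where
  "del_edge F e = (verts F, edges F - {e})"

definition subhypergraph :: "'a hgraph \<Rightarrow> 'a hgraph \<Rightarrow> bool" where
  "subhypergraph H' H \<longleftrightarrow>
     hypergraph H' \<and> verts H' \<subseteq> verts H \<and> edges H' \<subseteq> edges H"

text \<open>The injection \<open>\<phi>\<close> identifies all vertices of \<open>F\<close>, isolated ones included,
  with distinct vertices of \<open>H\<close>.\<close>

definition Berge :: "'a hgraph \<Rightarrow> 'b hgraph \<Rightarrow> bool" where
  "Berge F H \<longleftrightarrow>
     (\<exists>\<phi> f. inj_on \<phi> (verts F) \<and> \<phi> ` verts F \<subseteq> verts H \<and>
        bij_betw f (edges F) (edges H) \<and> (\<forall>e\<in>edges F. \<phi> ` e \<subseteq> f e))"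

definition Berge_free :: "'a hgraph \<Rightarrow> 'b hgraph \<Rightarrow> bool" where
  "Berge_free F H \<longleftrightarrow> \<not> (\<exists>H'. subhypergraph H' H \<and> Berge F H')"

definition contains_copy :: "'b hgraph \<Rightarrow> 'a hgraph \<Rightarrow> bool" where
  "contains_copy G F \<longleftrightarrow>
     (\<exists>\<phi>. inj_on \<phi> (verts F) \<and> \<phi> ` verts F \<subseteq> verts G \<and>
        (\<forall>e\<in>edges F. \<phi> ` e \<in> edges G))"

definition ramsey_prop :: "'a hgraph \<Rightarrow> 'b hgraph \<Rightarrow> nat \<Rightarrow> bool" where
  "ramsey_prop F G N \<longleftrightarrow>
     (\<forall>c :: nat set \<Rightarrow> bool.
        contains_copy ({..<N}, {e \<in> [{..<N}]\<^bsup>2\<^esup>. c e}) F \<or>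
        contains_copy ({..<N}, {e \<in> [{..<N}]\<^bsup>2\<^esup>. \<not> c e}) G)"

definition ramsey_number :: "'a hgraph \<Rightarrow> 'b hgraph \<Rightarrow> nat" where
  "ramsey_number F G = (LEAST N. ramsey_prop F G N)"

lemma contains_copy_of_homogeneous:
  assumes "graph F" "R \<subseteq> V" "finite R" "card R = card (verts F)"
    and hom: "\<And>v w. v \<in> R \<Longrightarrow> w \<in> R \<Longrightarrow> v \<noteq> w \<Longrightarrow> {v, w} \<in> E"
  shows "contains_copy (V, E) F"
proof -
  obtain \<phi> where \<phi>: "bij_betw \<phi> (verts F) R"
    using assms by (metis finite_same_card_bij graph_def)
  have "\<phi> ` e \<in> E" if "e \<in> edges F" for e
  proof -
    have "e \<in> [verts F]\<^bsup>2\<^esup>"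
      using assms(1) that by (auto simp: graph_def)
    then obtain x y where e: "e = {x, y}" "x \<noteq> y" "x \<in> verts F" "y \<in> verts F"
      unfolding nsets_def card_2_iff by blast
    have "\<phi> x \<in> R" "\<phi> y \<in> R" "\<phi> x \<noteq> \<phi> y"
      using \<phi> e by (auto simp: bij_betw_def inj_on_def)
    then show ?thesis using hom e by simp
  qed
  then show ?thesis
    using \<phi> assms(2) by (auto simp: contains_copy_def bij_betw_def)
qed

lemma ramsey_prop_ramsey_number:
  assumes "graph F" "graph G"
  shows "ramsey_prop F G (ramsey_number F G)"
proof -
  obtain r where r: "\<And>(V::nat set) E. finite V \<Longrightarrow> r \<le> card V \<Longrightarrow>
      \<exists>R\<subseteq>V. card R = card (verts F) \<and> clique R E \<or> card R = card (verts G) \<and> indep R E"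
    using ramsey2[where ?'a = nat, of "card (verts F)" "card (verts G)"] by blast
  have "ramsey_prop F G r"
    unfolding ramsey_prop_def
  proof
    fix c :: "nat set \<Rightarrow> bool"
    obtain R where R: "R \<subseteq> {..<r}"
      "card R = card (verts F) \<and> clique R {e. c e} \<or> card R = card (verts G) \<and> indep R {e. c e}"
      using r[of "{..<r}" "{e. c e}"] by auto
    have fin: "finite R" using R(1) finite_subset by blast
    show "contains_copy ({..<r}, {e \<in> [{..<r}]\<^bsup>2\<^esup>. c e}) F \<or>
        contains_copy ({..<r}, {e \<in> [{..<r}]\<^bsup>2\<^esup>. \<not> c e}) G"
      using R(2)
    proof
      assume a: "card R = card (verts F) \<and> clique R {e. c e}"
      have "contains_copy ({..<r}, {e \<in> [{..<r}]\<^bsup>2\<^esup>. c e}) F"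
        by (rule contains_copy_of_homogeneous[OF assms(1) R(1) fin])
          (use a R(1) in \<open>auto simp: clique_def nsets_def\<close>)
      then show ?thesis ..
    next
      assume a: "card R = card (verts G) \<and> indep R {e. c e}"
      have "contains_copy ({..<r}, {e \<in> [{..<r}]\<^bsup>2\<^esup>. \<not> c e}) G"
        by (rule contains_copy_of_homogeneous[OF assms(2) R(1) fin])
          (use a R(1) in \<open>auto simp: indep_def nsets_def\<close>)
      then show ?thesis ..
    qed
  qed
  then show ?thesis
    unfolding ramsey_number_def by (rule LeastI)
qed

end

theory Submission
  imports Defs "HOL-Analysis.Convex"
begin

text \<open>
Let \<open>k\<close> be the number of vertices and \<open>q\<close> the number of edges of \<open>F\<close>, and let \<open>R\<close> be the Ramsey
number.  Call a pair of vertices heavy if at least \<open>q\<close> hyperedges contain it, and light if fewer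
do, but at least one.  If some hyperedge \<open>h\<close> contained a copy of \<open>F\<close> minus \<open>e\<close> all of whose edges
are heavy, then \<open>h\<close> could represent \<open>e\<close>, and the remaining edges could greedily be given distinct
further hyperedges, so there would be a Berge copy of \<open>F\<close> (lemma
\<open>heavy_copy_not_Berge_free\<close>).  By the choice of \<open>R\<close>, every \<open>R\<close>-element subset of every hyperedge
therefore contains a copy of \<open>F\<close> whose edges are all light.

On the other hand the graph of light pairs has only \<open>o(n ^ k)\<close> homomorphic copies of \<open>F\<close>
(lemma \<open>few_light_homs\<close>): an injective homomorphism that sends no two edges of \<open>F\<close> into a common
hyperedge is a Berge copy, and any other one has a vertex whose image is confined, once the rest is
fixed, to the \<open>o(n)\<close> vertices of boundedly many hyperedges, or to a single vertex.  By the graph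
removal lemma, all light copies of \<open>F\<close> are destroyed by deleting a set \<open>D\<close> of \<open>o(n\<^sup>2)\<close> light
pairs.  Then \<open>D\<close> meets every \<open>R\<close>-subset of every hyperedge \<open>h\<close>, so by averaging it contains at least
a constant times \<open>|h|\<^sup>2\<close> pairs inside \<open>h\<close> (lemma \<open>pairs_hitting_all_subsets\<close>).  A light pair lies in
fewer than \<open>q\<close> hyperedges, hence summing over \<open>h\<close> bounds the sum of the \<open>|h|\<^sup>2\<close> by a constant times
\<open>|D|\<close>.

The removal lemma is proved from scratch, by the energy increment method.  A bounded number of
vertex sets generates a partition that approximates the graph in the following sense (theorem
\<open>strong_regularity\<close>): a further refinement of the partition captures the graph up to a cut-norm
error that is as small as desired in terms of the complexity of the coarse partition, while the
densities of the fine and of the coarse partition are close in square mean.  Deleting the edges in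
the few pairs of cells where the coarse data are degenerate leaves a graph in which a single copy of
\<open>F\<close> forces a positive proportion of all maps to be homomorphisms: the cut-norm error is
harmless by \<open>counting_lemma\<close>, and the square-mean error by \<open>hom_weight_structured_ge\<close>.
\<close>

section \<open>Conditional expectations on finite sets\<close>

definition cell :: "'x set \<Rightarrow> ('x \<Rightarrow> 'l) \<Rightarrow> 'x \<Rightarrow> 'x set" where
  "cell X p x = {y \<in> X. p y = p x}"

text \<open>The conditional expectation of \<open>f\<close>, for the uniform distribution on \<open>X\<close>, given the labelling
  \<open>p\<close>: the average of \<open>f\<close> over the points that share their label with \<open>x\<close>.\<close>

definition cexp :: "'x set \<Rightarrow> ('x \<Rightarrow> 'l) \<Rightarrow> ('x \<Rightarrow> real) \<Rightarrow> 'x \<Rightarrow> real" where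
  "cexp X p f x = (\<Sum>y\<in>cell X p x. f y) / real (card (cell X p x))"

text \<open>The squared norm of the conditional expectation.  Refining the labelling never decreases it, and it never
  exceeds the size of \<open>X\<close> when \<open>f\<close> takes values between 0 and 1, so it can grow by a fixed
  fraction of that size only boundedly often.\<close>

definition energy :: "'x set \<Rightarrow> ('x \<Rightarrow> 'l) \<Rightarrow> ('x \<Rightarrow> real) \<Rightarrow> real" where
  "energy X p f = (\<Sum>x\<in>X. (cexp X p f x)\<^sup>2)"

lemma cexp_cong: "p x = p y \<Longrightarrow> cexp X p f x = cexp X p f y"
  by (simp add: cexp_def cell_def)

lemma cell_subset: "cell X p x \<subseteq> X"
  by (auto simp: cell_def)

lemma card_cell_pos: "finite X \<Longrightarrow> x \<in> X \<Longrightarrow> card (cell X p x) > 0"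
  unfolding cell_def card_gt_0_iff by auto

lemma cexp_times_card:
  assumes "finite X" "x \<in> X"
  shows "cexp X p f x * real (card (cell X p x)) = (\<Sum>y\<in>cell X p x. f y)"
proof -
  have "real (card (cell X p x)) \<noteq> 0"
    using card_cell_pos[OF assms, of p] by simp
  then show ?thesis unfolding cexp_def by simp
qed

lemma cexp_nonneg:
  assumes "\<And>x. x \<in> X \<Longrightarrow> 0 \<le> f x"
  shows "0 \<le> cexp X p f x"
  unfolding cexp_def using assms cell_subset[of X p x]
  by (intro divide_nonneg_nonneg sum_nonneg) auto

lemma cexp_le_1:
  assumes "finite X" "x \<in> X" "\<And>x. x \<in> X \<Longrightarrow> f x \<le> 1"
  shows "cexp X p f x \<le> 1"
proof -
  have "(\<Sum>y\<in>cell X p x. f y) \<le> (\<Sum>y\<in>cell X p x. 1)"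
    using assms(3) cell_subset[of X p x] by (intro sum_mono) auto
  then show ?thesis
    using card_cell_pos[OF assms(1,2), of p] by (simp add: cexp_def)
qed

text \<open>Conditional expectation is the orthogonal projection onto the functions that are constant on the
  cells; this is the orthogonality relation.\<close>

lemma sum_cexp_mult:
  assumes fin: "finite X"
    and g: "\<And>x y. x \<in> X \<Longrightarrow> y \<in> X \<Longrightarrow> p x = p y \<Longrightarrow> g x = g y"
  shows "(\<Sum>x\<in>X. cexp X p f x * g x) = (\<Sum>x\<in>X. f x * g x)"
proof -
  have "(\<Sum>x\<in>X. cexp X p f x * g x)
      = (\<Sum>l\<in>p ` X. \<Sum>x\<in>{x \<in> X. p x = l}. cexp X p f x * g x)"
    by (rule sum.image_gen[OF fin])
  also have "\<dots> = (\<Sum>l\<in>p ` X. \<Sum>x\<in>{x \<in> X. p x = l}. f x * g x)"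
  proof (rule sum.cong[OF refl])
    fix l assume "l \<in> p ` X"
    then obtain z where z: "z \<in> X" "l = p z" by blast
    have c: "{x \<in> X. p x = l} = cell X p z"
      using z by (auto simp: cell_def)
    have *: "g x = g z \<and> cexp X p f x = cexp X p f z" if "x \<in> cell X p z" for x
      using that z g[of x z] cexp_cong[of p x z] by (auto simp: cell_def)
    have "(\<Sum>x\<in>cell X p z. cexp X p f x * g x) = (cexp X p f z * card (cell X p z)) * g z"
      using * by simp
    also have "\<dots> = (\<Sum>x\<in>cell X p z. f x * g x)"
      using * by (simp add: cexp_times_card[OF fin z(1)] sum_distrib_right)
    finally show "(\<Sum>x\<in>{x \<in> X. p x = l}. cexp X p f x * g x)
        = (\<Sum>x\<in>{x \<in> X. p x = l}. f x * g x)" using c by simp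
  qed
  also have "\<dots> = (\<Sum>x\<in>X. f x * g x)"
    by (rule sum.image_gen[OF fin, symmetric])
  finally show ?thesis .
qed

lemma sum_cexp: "finite X \<Longrightarrow> (\<Sum>x\<in>X. cexp X p f x) = (\<Sum>x\<in>X. f x)"
  using sum_cexp_mult[of X p "\<lambda>_. 1" f] by simp

text \<open>Pythagoras for the nested projections belonging to a labelling and a refinement of it.\<close>

lemma energy_increment:
  assumes fin: "finite X"
    and ref: "\<And>x y. x \<in> X \<Longrightarrow> y \<in> X \<Longrightarrow> q x = q y \<Longrightarrow> p x = p y"
  shows "(\<Sum>x\<in>X. (cexp X q f x - cexp X p f x)\<^sup>2) = energy X q f - energy X p f"
proof -
  have "(\<Sum>x\<in>X. cexp X q f x * cexp X p f x) = (\<Sum>x\<in>X. f x * cexp X p f x)"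
    by (rule sum_cexp_mult[OF fin]) (metis ref cexp_cong)
  also have "\<dots> = (\<Sum>x\<in>X. cexp X p f x * cexp X p f x)"
    by (rule sum_cexp_mult[OF fin, symmetric]) (metis cexp_cong)
  finally have cross: "(\<Sum>x\<in>X. cexp X q f x * cexp X p f x) = energy X p f"
    by (simp add: energy_def power2_eq_square)
  have "(\<Sum>x\<in>X. (cexp X q f x - cexp X p f x)\<^sup>2)
      = energy X q f - 2 * (\<Sum>x\<in>X. cexp X q f x * cexp X p f x) + energy X p f"
    unfolding energy_def power2_diff sum.distrib sum_subtractf sum_distrib_left
    by (simp add: mult.assoc)
  with cross show ?thesis by simp
qed

lemma energy_nonneg: "0 \<le> energy X p f"
  by (simp add: energy_def sum_nonneg)

lemma energy_le_card:
  assumes "finite X" "\<And>x. x \<in> X \<Longrightarrow> 0 \<le> f x \<and> f x \<le> 1"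
  shows "energy X p f \<le> real (card X)"
proof -
  have "(cexp X p f x)\<^sup>2 \<le> 1" if "x \<in> X" for x
    using cexp_nonneg[of X f p x] cexp_le_1[OF assms(1) that, of f p] assms(2)
    by (simp add: power_le_one)
  then have "energy X p f \<le> (\<Sum>x\<in>X. 1)"
    unfolding energy_def by (intro sum_mono) auto
  then show ?thesis by simp
qed

text \<open>If \<open>f\<close> differs noticeably from its conditional expectation on a set \<open>Y\<close>, then refining the
  labelling so that it sees \<open>Y\<close> increases the energy noticeably.  On a union of cells of \<open>q\<close>,
  the function and its projection along \<open>q\<close> have the same sum, so the discrepancy is a sum of
  differences of the two projections, to which the Cauchy--Schwarz inequality applies.\<close>

lemma discrepancy_le_energy_increment:
  assumes fin: "finite X"
    and ref: "\<And>x y. x \<in> X \<Longrightarrow> y \<in> X \<Longrightarrow> q x = q y \<Longrightarrow> p x = p y"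
    and Y: "Y \<subseteq> X" "\<And>x y. x \<in> X \<Longrightarrow> y \<in> X \<Longrightarrow> q x = q y \<Longrightarrow> x \<in> Y \<longleftrightarrow> y \<in> Y"
  shows "(\<Sum>x\<in>Y. f x - cexp X p f x)\<^sup>2 \<le> real (card X) * (energy X q f - energy X p f)"
proof -
  have restrict: "(\<Sum>x\<in>Y. h x) = (\<Sum>x\<in>X. h x * of_bool (x \<in> Y))" for h :: "'a \<Rightarrow> real"
  proof -
    have "(\<Sum>x\<in>Y. h x) = (\<Sum>x\<in>X \<inter> Y. h x)"
      using Y(1) by (simp add: Int_absorb1)
    also have "\<dots> = (\<Sum>x\<in>X. if x \<in> Y then h x else 0)"
      by (rule sum.inter_restrict[OF fin])
    also have "\<dots> = (\<Sum>x\<in>X. h x * of_bool (x \<in> Y))"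
      by (rule sum.cong) simp_all
    finally show ?thesis .
  qed
  have "(\<Sum>x\<in>Y. f x) = (\<Sum>x\<in>Y. cexp X q f x)"
  proof -
    have "(\<Sum>x\<in>X. cexp X q f x * of_bool (x \<in> Y)) = (\<Sum>x\<in>X. f x * of_bool (x \<in> Y))"
    proof (rule sum_cexp_mult[OF fin])
      fix x y assume "x \<in> X" "y \<in> X" "q x = q y"
      then have "x \<in> Y \<longleftrightarrow> y \<in> Y" by (rule Y(2))
      then show "of_bool (x \<in> Y) = (of_bool (y \<in> Y) :: real)" by simp
    qed
    then show ?thesis
      by (simp only: restrict[of f] restrict[of "cexp X q f"])
  qed
  then have "(\<Sum>x\<in>Y. f x - cexp X p f x)\<^sup>2 = (\<Sum>x\<in>Y. cexp X q f x - cexp X p f x)\<^sup>2"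
    by (simp add: sum_subtractf)
  also have "\<dots> \<le> (\<Sum>x\<in>Y. (cexp X q f x - cexp X p f x)\<^sup>2) * card Y"
    using sum_squared_le_sum_of_squares[of "\<lambda>x. cexp X q f x - cexp X p f x" Y] by (simp add: mult.commute)
  also have "\<dots> \<le> (\<Sum>x\<in>X. (cexp X q f x - cexp X p f x)\<^sup>2) * card X"
    using fin Y(1) card_mono[OF fin Y(1)] by (intro mult_mono sum_mono2 sum_nonneg) simp_all
  finally show ?thesis
    by (simp add: energy_increment[OF fin ref] mult.commute)
qed

section \<open>Regularity by energy increment\<close>

text \<open>A partition is represented by a list of sets that generate it: two points are in the same cell if
  they have the same membership profile.  Refinement is then just appending to the list, and the length
  of the list bounds the number of cells.\<close>

definition profile :: "'b set list \<Rightarrow> 'b \<Rightarrow> bool list" where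
  "profile As x = map (\<lambda>A. x \<in> A) As"

definition profile2 :: "'b set list \<Rightarrow> 'b \<times> 'b \<Rightarrow> bool list \<times> bool list" where
  "profile2 As = map_prod (profile As) (profile As)"

lemma profile2_append: "profile2 (As @ Bs) z = profile2 (As @ Bs) w \<Longrightarrow> profile2 As z = profile2 As w"
  by (cases z; cases w) (simp add: profile2_def profile_def)

lemma card_profile_image: "card (profile As ` V) \<le> 2 ^ length As"
proof -
  have "profile As ` V \<subseteq> {xs. set xs \<subseteq> (UNIV :: bool set) \<and> length xs = length As}"
    by (auto simp: profile_def)
  then have "card (profile As ` V) \<le> card {xs. set xs \<subseteq> (UNIV :: bool set) \<and> length xs = length As}"
    by (intro card_mono finite_lists_length_eq) auto
  then show ?thesis
    using card_lists_length_eq[of "UNIV :: bool set" "length As"] by simp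
qed

text \<open>The cut norm of the difference between \<open>f\<close> and its block averages is at most \<open>\<eta>\<close>, relative to the
  number of all pairs.\<close>

definition cut_regular :: "'b set \<Rightarrow> ('b \<times> 'b \<Rightarrow> real) \<Rightarrow> 'b set list \<Rightarrow> real \<Rightarrow> bool" where
  "cut_regular V f As \<eta> \<longleftrightarrow> (\<forall>S\<subseteq>V. \<forall>T\<subseteq>V.
     \<bar>\<Sum>z\<in>S \<times> T. f z - cexp (V \<times> V) (profile2 As) f z\<bar> \<le> \<eta> * real (card (V \<times> V)))"

lemma irregular_energy_increment:
  assumes fin: "finite V" and "0 \<le> \<eta>" and irr: "\<not> cut_regular V f As \<eta>"
  obtains S T where "energy (V \<times> V) (profile2 (As @ [S, T])) f
    \<ge> energy (V \<times> V) (profile2 As) f + \<eta>\<^sup>2 * real (card (V \<times> V))"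
proof -
  let ?X = "V \<times> V"
  obtain S T where ST: "S \<subseteq> V" "T \<subseteq> V"
      "\<eta> * real (card ?X) < \<bar>\<Sum>z\<in>S \<times> T. f z - cexp ?X (profile2 As) f z\<bar>"
    using irr by (auto simp: cut_regular_def not_le)
  have "(\<eta> * real (card ?X))\<^sup>2 \<le> (\<Sum>z\<in>S \<times> T. f z - cexp ?X (profile2 As) f z)\<^sup>2"
    using ST(3) \<open>0 \<le> \<eta>\<close> by (subst abs_le_square_iff[symmetric]) (simp add: abs_mult)
  also have "\<dots> \<le> real (card ?X) *
      (energy ?X (profile2 (As @ [S, T])) f - energy ?X (profile2 As) f)"
  proof (rule discrepancy_le_energy_increment)
    show "finite ?X" using fin by simp
    show "S \<times> T \<subseteq> ?X" using ST by auto
    show "(x \<in> S \<times> T) = (y \<in> S \<times> T)"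
      if "profile2 (As @ [S, T]) x = profile2 (As @ [S, T]) y" for x y
      using that by (cases x; cases y) (auto simp: profile2_def profile_def)
  qed (rule profile2_append)
  finally have *: "(\<eta> * real (card ?X))\<^sup>2 \<le> real (card ?X) *
      (energy ?X (profile2 (As @ [S, T])) f - energy ?X (profile2 As) f)" .
  have "card ?X \<noteq> 0"
  proof
    assume "card ?X = 0"
    then have "V = {}" using fin by auto
    then show False using ST by simp
  qed
  then have "\<eta>\<^sup>2 * real (card ?X) \<le> energy ?X (profile2 (As @ [S, T])) f - energy ?X (profile2 As) f"
    using * by (simp add: power2_eq_square mult.assoc mult.left_commute)
  then show ?thesis using that by (simp add: algebra_simps)
qed

text \<open>The regularity lemma of Frieze and Kannan, as a statement about refinements of a given partition.
  As long as the partition is irregular, the two sides of a witnessing rectangle can be added to it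
  at a gain of \<open>\<eta>\<^sup>2\<close> in relative energy, which is possible at most \<open>1 / \<eta>\<^sup>2\<close> times.\<close>

lemma weak_regularity:
  assumes fin: "finite V" and f: "\<And>z. z \<in> V \<times> V \<Longrightarrow> 0 \<le> f z \<and> f z \<le> 1"
    and "0 < \<eta>" and k: "1 < real k * \<eta>\<^sup>2"
  shows "\<exists>Bs. length Bs \<le> 2 * k \<and> cut_regular V f (As @ Bs) \<eta>"
proof -
  let ?X = "V \<times> V"
  let ?en = "\<lambda>Bs. energy ?X (profile2 Bs) f"
  have step: "\<exists>Bs. length Bs \<le> 2 * j \<and>
      (cut_regular V f (As @ Bs) \<eta> \<or> real j * \<eta>\<^sup>2 * real (card ?X) \<le> ?en (As @ Bs))" for j
  proof (induction j)
    case 0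
    show ?case using energy_nonneg by (intro exI[of _ "[]"]) auto
  next
    case (Suc j)
    then obtain Bs where Bs: "length Bs \<le> 2 * j"
      "cut_regular V f (As @ Bs) \<eta> \<or> real j * \<eta>\<^sup>2 * real (card ?X) \<le> ?en (As @ Bs)" by blast
    show ?case
    proof (cases "cut_regular V f (As @ Bs) \<eta>")
      case True
      then show ?thesis using Bs(1) by (intro exI[of _ Bs]) auto
    next
      case False
      obtain S T where "?en ((As @ Bs) @ [S, T]) \<ge> ?en (As @ Bs) + \<eta>\<^sup>2 * real (card ?X)"
        using irregular_energy_increment[OF fin _ False] \<open>0 < \<eta>\<close> by auto
      then show ?thesis
        using Bs False by (intro exI[of _ "Bs @ [S, T]"]) (auto simp: algebra_simps)
    qed
  qed
  obtain Bs where Bs: "length Bs \<le> 2 * k"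
      "cut_regular V f (As @ Bs) \<eta> \<or> real k * \<eta>\<^sup>2 * real (card ?X) \<le> ?en (As @ Bs)"
    using step by blast
  have "cut_regular V f (As @ Bs) \<eta>"
  proof (cases "V = {}")
    case True
    then show ?thesis by (simp add: cut_regular_def)
  next
    case False
    have "?en (As @ Bs) \<le> real (card ?X)"
      using energy_le_card[of ?X f] fin f by blast
    also have "\<dots> < real k * \<eta>\<^sup>2 * real (card ?X)"
      using k fin False by (simp add: card_gt_0_iff)
    finally show ?thesis using Bs(2) by auto
  qed
  with Bs(1) show ?thesis by blast
qed

text \<open>The analytic form of the strong regularity lemma, with a tolerance \<open>\<eta>\<close> that may depend on the
  complexity of the coarse partition \<open>As\<close>.  Repeatedly apply weak regularity with the tolerance
  dictated by the current partition.  A round either gains little energy, and then the partitions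
  before and after it are as required, or gains \<open>\<epsilon>\<close>, which can happen at most \<open>1 / \<epsilon>\<close> times.
  The bound \<open>K\<close> is uniform in the vertex set and the function.\<close>

theorem strong_regularity:
  fixes \<eta> :: "nat \<Rightarrow> real"
  assumes "0 < \<epsilon>" and \<eta>: "\<And>m. 0 < \<eta> m"
  obtains K where "\<forall>(V :: 'b set) f. finite V \<and> (\<forall>z\<in>V \<times> V. 0 \<le> f z \<and> f z \<le> 1) \<longrightarrow>
    (\<exists>As Bs. length As \<le> K \<and> cut_regular V f (As @ Bs) (\<eta> (length As)) \<and>
      energy (V \<times> V) (profile2 (As @ Bs)) f
        \<le> energy (V \<times> V) (profile2 As) f + \<epsilon> * real (card (V \<times> V)))"
proof -
  have "\<exists>k::nat. 1 < real k * (\<eta> m)\<^sup>2" for m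
    using reals_Archimedean3[of "(\<eta> m)\<^sup>2"] \<eta>[of m] by (metis zero_less_power)
  then obtain L :: "nat \<Rightarrow> nat" where L: "\<And>m. 1 < real (L m) * (\<eta> m)\<^sup>2"
    by metis
  let ?en = "\<lambda>(V :: 'b set) f As. energy (V \<times> V) (profile2 As) f"
  define good where "good K V f \<longleftrightarrow> (\<exists>As Bs. length As \<le> K \<and>
      cut_regular V f (As @ Bs) (\<eta> (length As)) \<and>
      ?en V f (As @ Bs) \<le> ?en V f As + \<epsilon> * real (card (V \<times> V)))" for K and V :: "'b set" and f
  define rich where "rich K t V f \<longleftrightarrow> (\<exists>As. length As \<le> K \<and> t * real (card (V \<times> V)) \<le> ?en V f As)"
    for K and t :: real and V :: "'b set" and f
  define admissible where "admissible V f \<longleftrightarrow> finite V \<and> (\<forall>z\<in>V \<times> V. 0 \<le> f z \<and> f z \<le> (1::real))"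
    for V :: "'b set" and f
  have step: "\<exists>K. \<forall>V f. admissible V f \<longrightarrow> good K V f \<or> rich K (real j * \<epsilon>) V f" for j
  proof (induction j)
    case 0
    have "rich 0 (real 0 * \<epsilon>) V f" for V f
      unfolding rich_def using energy_nonneg by (intro exI[of _ "[]"]) auto
    then show ?case by blast
  next
    case (Suc j)
    then obtain K where K: "\<And>V f. admissible V f \<Longrightarrow> good K V f \<or> rich K (real j * \<epsilon>) V f"
      by blast
    \<comment> \<open>The current partition has length at most \<open>K\<close>, so the sum bounds the length that any
      round can add.\<close>
    define K' where "K' = K + 2 * (\<Sum>m\<le>K. L m)"
    have "good K' V f \<or> rich K' (real (Suc j) * \<epsilon>) V f" if adm: "admissible V f" for V f
      using K[OF adm]
    proof
      assume "good K V f"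
      then obtain As Bs where "length As \<le> K" "cut_regular V f (As @ Bs) (\<eta> (length As))"
          "?en V f (As @ Bs) \<le> ?en V f As + \<epsilon> * real (card (V \<times> V))"
        unfolding good_def by blast
      then have "good K' V f"
        unfolding good_def K'_def by (intro exI[of _ As] exI[of _ Bs]) auto
      then show ?thesis ..
    next
      assume "rich K (real j * \<epsilon>) V f"
      then obtain As where As: "length As \<le> K" "real j * \<epsilon> * real (card (V \<times> V)) \<le> ?en V f As"
        unfolding rich_def by blast
      have fin: "finite V" and bd: "\<And>z. z \<in> V \<times> V \<Longrightarrow> 0 \<le> f z \<and> f z \<le> 1"
        using adm by (auto simp: admissible_def)
      obtain Bs where Bs: "length Bs \<le> 2 * L (length As)"
          "cut_regular V f (As @ Bs) (\<eta> (length As))"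
        using weak_regularity[OF fin _ \<eta> L] bd by blast
      have "L (length As) \<le> (\<Sum>m\<le>K. L m)"
        using As(1) by (intro member_le_sum) auto
      then have len: "length (As @ Bs) \<le> K'" using As(1) Bs(1) by (simp add: K'_def)
      show ?thesis
      proof (cases "?en V f (As @ Bs) \<le> ?en V f As + \<epsilon> * real (card (V \<times> V))")
        case True
        then have "good K' V f"
          unfolding good_def using len Bs(2) by (intro exI[of _ As] exI[of _ Bs]) auto
        then show ?thesis ..
      next
        case False
        then have "real (Suc j) * \<epsilon> * real (card (V \<times> V)) \<le> ?en V f (As @ Bs)"
          using As(2) by (simp add: algebra_simps)
        then have "rich K' (real (Suc j) * \<epsilon>) V f"
          unfolding rich_def using len by blast
        then show ?thesis ..
      qed
    qed
    then show ?case by blast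
  qed
  obtain j :: nat where j: "1 < real j * \<epsilon>"
    using reals_Archimedean3[OF \<open>0 < \<epsilon>\<close>] by blast
  obtain K where K: "\<And>V f. admissible V f \<Longrightarrow> good K V f \<or> rich K (real j * \<epsilon>) V f"
    using step[of j] by blast
  have "good K V f" if adm: "admissible V f" for V f
  proof (cases "V = {}")
    case True
    then show ?thesis unfolding good_def by (intro exI[of _ "[]"]) (simp add: cut_regular_def energy_def)
  next
    case False
    have "\<not> rich K (real j * \<epsilon>) V f"
    proof
      assume "rich K (real j * \<epsilon>) V f"
      then obtain As where "real j * \<epsilon> * real (card (V \<times> V)) \<le> ?en V f As"
        unfolding rich_def by blast
      also have "?en V f As \<le> real (card (V \<times> V))"
        using energy_le_card[of "V \<times> V" f] adm unfolding admissible_def by blast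
      also have "\<dots> < real j * \<epsilon> * real (card (V \<times> V))"
        using j adm False by (simp add: card_gt_0_iff admissible_def)
      finally show False by simp
    qed
    then show ?thesis using K[OF adm] by blast
  qed
  then show ?thesis
    using that[of K] unfolding good_def admissible_def by blast
qed

section \<open>Counting homomorphisms\<close>

text \<open>Homomorphism counts are sums over maps \<open>x\<close> on \<open>U\<close>.  To estimate the contribution of one edge, the
  coordinates at its two ends are split off one after the other.\<close>

lemma sum_PiE_update:
  assumes "u \<in> U"
  shows "(\<Sum>x\<in>PiE U I. \<phi> x) = (\<Sum>z\<in>PiE (U - {u}) I. \<Sum>a\<in>I u. \<phi> (z(u := a)))"
proof -
  have "PiE U I = PiE (insert u (U - {u})) I"
    using assms by (simp add: insert_absorb)
  also have "\<dots> = (\<lambda>(y, g). g(u := y)) ` (I u \<times> PiE (U - {u}) I)"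
    by (rule PiE_insert_eq)
  finally have "(\<Sum>x\<in>PiE U I. \<phi> x)
      = (\<Sum>w\<in>I u \<times> PiE (U - {u}) I. \<phi> ((\<lambda>(y, g). g(u := y)) w))"
    by (simp add: sum.reindex inj_combinator)
  also have "\<dots> = (\<Sum>a\<in>I u. \<Sum>z\<in>PiE (U - {u}) I. \<phi> (z(u := a)))"
    by (simp add: sum.cartesian_product case_prod_beta)
  also have "\<dots> = (\<Sum>z\<in>PiE (U - {u}) I. \<Sum>a\<in>I u. \<phi> (z(u := a)))"
    by (rule sum.swap)
  finally show ?thesis .
qed

lemma sum_PiE_update2:
  assumes "u \<in> U" "v \<in> U" "u \<noteq> v"
  shows "(\<Sum>x\<in>PiE U I. \<phi> x)
    = (\<Sum>z\<in>PiE (U - {u} - {v}) I. \<Sum>a\<in>I u. \<Sum>b\<in>I v. \<phi> (z(u := a, v := b)))"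
proof -
  have "(\<Sum>x\<in>PiE U I. \<phi> x) = (\<Sum>z\<in>PiE (U - {u}) I. \<Sum>a\<in>I u. \<phi> (z(u := a)))"
    by (rule sum_PiE_update[OF assms(1)])
  also have "\<dots> = (\<Sum>z\<in>PiE (U - {u} - {v}) I. \<Sum>b\<in>I v. \<Sum>a\<in>I u. \<phi> (z(v := b, u := a)))"
    by (rule sum_PiE_update) (use assms in auto)
  also have "\<dots> = (\<Sum>z\<in>PiE (U - {u} - {v}) I. \<Sum>a\<in>I u. \<Sum>b\<in>I v. \<phi> (z(u := a, v := b)))"
  proof (rule sum.cong[OF refl])
    fix z
    have "(\<Sum>b\<in>I v. \<Sum>a\<in>I u. \<phi> (z(v := b, u := a)))
        = (\<Sum>b\<in>I v. \<Sum>a\<in>I u. \<phi> (z(u := a, v := b)))"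
      by (simp only: fun_upd_twist[OF assms(3)])
    also have "\<dots> = (\<Sum>a\<in>I u. \<Sum>b\<in>I v. \<phi> (z(u := a, v := b)))"
      by (rule sum.swap)
    finally show "(\<Sum>b\<in>I v. \<Sum>a\<in>I u. \<phi> (z(v := b, u := a)))
        = (\<Sum>a\<in>I u. \<Sum>b\<in>I v. \<phi> (z(u := a, v := b)))" .
  qed
  finally show ?thesis .
qed

lemma sum_PiE_marginal:
  fixes h :: "'b \<times> 'b \<Rightarrow> real"
  assumes "u \<in> U" "v \<in> U" "u \<noteq> v"
  shows "(\<Sum>x\<in>PiE U I. h (x u, x v)) = real (card (PiE (U - {u} - {v}) I)) * (\<Sum>z\<in>I u \<times> I v. h z)"
  using assms by (simp add: sum_PiE_update2[OF assms] sum.cartesian_product case_prod_beta)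

lemma card_PiE_split:
  assumes "u \<in> U" "v \<in> U" "u \<noteq> v"
  shows "real (card (PiE U I)) = real (card (PiE (U - {u} - {v}) I)) * real (card (I u \<times> I v))"
  using sum_PiE_marginal[OF assms, of "\<lambda>_. 1" I] by simp

lemma sum_negative_part_le:
  fixes r a :: "'b \<Rightarrow> real"
  assumes "finite I" "\<And>x. x \<in> I \<Longrightarrow> 0 \<le> a x \<and> a x \<le> 1"
  shows "(\<Sum>x\<in>{x \<in> I. r x < 0}. r x) \<le> (\<Sum>x\<in>I. r x * a x)"
proof -
  have "(\<Sum>x\<in>{x \<in> I. r x < 0}. r x) = (\<Sum>x\<in>I. if r x < 0 then r x else 0)"
    by (rule sum.inter_filter[OF assms(1)])
  also have "\<dots> \<le> (\<Sum>x\<in>I. r x * a x)"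
  proof (rule sum_mono)
    fix x assume "x \<in> I"
    then have a: "0 \<le> a x" "a x \<le> 1" using assms(2) by auto
    show "(if r x < 0 then r x else 0) \<le> r x * a x"
    proof (cases "r x < 0")
      case True
      then have "r x * 1 \<le> r x * a x" using a by (intro mult_left_mono_neg) auto
      then show ?thesis using True by simp
    next
      case False
      then show ?thesis using a by simp
    qed
  qed
  finally show ?thesis .
qed

text \<open>A lower bound on the sums of \<open>h\<close> over rectangles also holds for sums weighted by products of functions with
  values between 0 and 1: the weighted sum is affine in each weight, so it is minimal when both weights
  are indicator functions.\<close>

lemma cut_bound_weighted:
  fixes h :: "'b \<times> 'b \<Rightarrow> real"
  assumes fin: "finite I" "finite J"
    and cut: "\<And>S T. S \<subseteq> I \<Longrightarrow> T \<subseteq> J \<Longrightarrow> - c \<le> (\<Sum>z\<in>S \<times> T. h z)"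
    and a: "\<And>x. x \<in> I \<Longrightarrow> 0 \<le> a x \<and> a x \<le> 1" and b: "\<And>y. y \<in> J \<Longrightarrow> 0 \<le> b y \<and> b y \<le> 1"
  shows "- c \<le> (\<Sum>x\<in>I. \<Sum>y\<in>J. h (x, y) * (a x * b y))"
proof -
  \<comment> \<open>The worst weights select the points where the partial sums are negative.\<close>
  define r where "r x = (\<Sum>y\<in>J. h (x, y) * b y)" for x
  define S where "S = {x \<in> I. r x < 0}"
  define s where "s y = (\<Sum>x\<in>S. h (x, y))" for y
  define T where "T = {y \<in> J. s y < 0}"
  have "- c \<le> (\<Sum>z\<in>S \<times> T. h z)" by (rule cut) (auto simp: S_def T_def)
  also have "\<dots> = (\<Sum>x\<in>S. \<Sum>y\<in>T. h (x, y))"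
    by (simp add: sum.cartesian_product case_prod_beta)
  also have "\<dots> = (\<Sum>y\<in>T. s y)"
    unfolding s_def by (rule sum.swap)
  also have "\<dots> \<le> (\<Sum>y\<in>J. s y * b y)"
    unfolding T_def by (rule sum_negative_part_le) (use fin b in auto)
  also have "\<dots> = (\<Sum>x\<in>S. r x)"
    unfolding s_def r_def sum_distrib_right by (rule sum.swap)
  also have "\<dots> \<le> (\<Sum>x\<in>I. r x * a x)"
    unfolding S_def by (rule sum_negative_part_le) (use fin a in auto)
  also have "\<dots> = (\<Sum>x\<in>I. \<Sum>y\<in>J. h (x, y) * (a x * b y))"
    unfolding r_def sum_distrib_right by (simp add: mult.assoc mult.commute[of "b _"])
  finally show ?thesis .
qed

text \<open>After fixing all coordinates except those at \<open>u\<close> and \<open>v\<close>, no remaining factor depends on both of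
  them, because there is at most one edge between \<open>u\<close> and \<open>v\<close>.  The remaining product thus splits into a weight
  in the first variable and a weight in the second, to which the cut bound applies.\<close>

lemma cut_bound_in_product:
  fixes h :: "'b \<times> 'b \<Rightarrow> real" and W :: "'a \<times> 'a \<Rightarrow> 'b \<times> 'b \<Rightarrow> real"
  assumes A: "finite A" "A \<subseteq> U \<times> U" "asym A" and uv: "(u, v) \<in> A"
    and fin: "finite V" and I: "\<And>w. w \<in> U \<Longrightarrow> I w \<subseteq> V"
    and W: "\<And>e z. e \<in> A \<Longrightarrow> z \<in> V \<times> V \<Longrightarrow> 0 \<le> W e z \<and> W e z \<le> 1"
    and cut: "\<And>S T. S \<subseteq> V \<Longrightarrow> T \<subseteq> V \<Longrightarrow> - c \<le> (\<Sum>z\<in>S \<times> T. h z)"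
  shows "- c * real (card (PiE (U - {u} - {v}) I))
    \<le> (\<Sum>x\<in>PiE U I. h (x u, x v) * (\<Prod>e\<in>A - {(u, v)}. W e (x (fst e), x (snd e))))"
proof -
  have u: "u \<in> U" "v \<in> U" and ne: "u \<noteq> v" and vu: "(v, u) \<notin> A"
    using A uv by (auto dest: asymD)
  have loop: "(w, w) \<notin> A" for w using A(3) by (auto dest: asymD)
  let ?w = "\<lambda>(e :: 'a \<times> 'a) (x :: 'a \<Rightarrow> 'b). W e (x (fst e), x (snd e))"
  \<comment> \<open>The factors that involve the coordinate \<open>u\<close>; none of them involves \<open>v\<close>.\<close>
  define A1 where "A1 = {e \<in> A - {(u, v)}. fst e = u \<or> snd e = u}"
  define A2 where "A2 = {e \<in> A - {(u, v)}. fst e \<noteq> u \<and> snd e \<noteq> u}"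
  have split: "A - {(u, v)} = A1 \<union> A2" "A1 \<inter> A2 = {}" "finite A1" "finite A2"
    using A(1) by (auto simp: A1_def A2_def)
  have A1v: "fst e \<noteq> v \<and> snd e \<noteq> v" if "e \<in> A1" for e
    using that ne vu loop by (cases e) (auto simp: A1_def)
  have A2u: "fst e \<noteq> u \<and> snd e \<noteq> u" if "e \<in> A2" for e
    using that by (auto simp: A2_def)
  have sub: "e \<in> A \<and> fst e \<in> U \<and> snd e \<in> U" if "e \<in> A1 \<union> A2" for e
    using that A(2) by (cases e) (auto simp: A1_def A2_def)
  have inner: "- c \<le> (\<Sum>a\<in>I u. \<Sum>b\<in>I v. h (a, b) * (\<Prod>e\<in>A - {(u, v)}. ?w e (z(u := a, v := b))))"
    if z: "z \<in> PiE (U - {u} - {v}) I" for z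
  proof -
    define \<alpha> where "\<alpha> a = (\<Prod>e\<in>A1. ?w e (z(u := a)))" for a
    define \<beta> where "\<beta> b = (\<Prod>e\<in>A2. ?w e (z(v := b)))" for b
    have zV: "z w \<in> V" if "w \<in> U" "w \<noteq> u" "w \<noteq> v" for w
      using z that I[of w] by (auto simp: PiE_def Pi_def)
    have "- c \<le> (\<Sum>a\<in>I u. \<Sum>b\<in>I v. h (a, b) * (\<alpha> a * \<beta> b))"
    proof (rule cut_bound_weighted)
      show "finite (I u)" "finite (I v)"
        using fin I u by (meson finite_subset)+
      show "- c \<le> (\<Sum>z\<in>S \<times> T. h z)" if "S \<subseteq> I u" "T \<subseteq> I v" for S T
        using cut I u that by (meson subset_trans)
      show "0 \<le> \<alpha> a \<and> \<alpha> a \<le> 1" if a: "a \<in> I u" for a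
      proof -
        have "0 \<le> ?w e (z(u := a)) \<and> ?w e (z(u := a)) \<le> 1" if e: "e \<in> A1" for e
          using A1v[OF e] sub[of e] e a I[of u] u zV by (intro W) auto
        then show ?thesis unfolding \<alpha>_def by (auto intro: prod_nonneg prod_le_1)
      qed
      show "0 \<le> \<beta> b \<and> \<beta> b \<le> 1" if b: "b \<in> I v" for b
      proof -
        have "0 \<le> ?w e (z(v := b)) \<and> ?w e (z(v := b)) \<le> 1" if e: "e \<in> A2" for e
          using A2u[OF e] sub[of e] e b I[of v] u zV by (intro W) auto
        then show ?thesis unfolding \<beta>_def by (auto intro: prod_nonneg prod_le_1)
      qed
    qed
    also have "\<dots> = (\<Sum>a\<in>I u. \<Sum>b\<in>I v. h (a, b) *
        (\<Prod>e\<in>A - {(u, v)}. ?w e (z(u := a, v := b))))"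
    proof (intro sum.cong refl)
      fix a b
      have "(\<Prod>e\<in>A1. ?w e (z(u := a, v := b))) = \<alpha> a"
        unfolding \<alpha>_def by (rule prod.cong) (use A1v in auto)
      moreover have "(\<Prod>e\<in>A2. ?w e (z(u := a, v := b))) = \<beta> b"
        unfolding \<beta>_def by (rule prod.cong) (use A2u in auto)
      ultimately show "h (a, b) * (\<alpha> a * \<beta> b) = h (a, b) *
          (\<Prod>e\<in>A - {(u, v)}. ?w e (z(u := a, v := b)))"
        using split by (simp add: prod.union_disjoint)
    qed
    finally show ?thesis .
  qed
  have "- c * real (card (PiE (U - {u} - {v}) I)) = (\<Sum>z\<in>PiE (U - {u} - {v}) I. - c)"
    by simp
  also have "\<dots> \<le> (\<Sum>z\<in>PiE (U - {u} - {v}) I. \<Sum>a\<in>I u. \<Sum>b\<in>I v.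
      h (a, b) * (\<Prod>e\<in>A - {(u, v)}. ?w e (z(u := a, v := b))))"
    by (rule sum_mono) (rule inner)
  also have "\<dots> = (\<Sum>x\<in>PiE U I. h (x u, x v) * (\<Prod>e\<in>A - {(u, v)}. ?w e x))"
    using ne by (simp add: sum_PiE_update2[OF u ne])
  finally show ?thesis .
qed

text \<open>If \<open>f\<close> is the indicator function of a set of pairs \<open>G\<close>, this is the indicator of \<open>x\<close> being a
  homomorphism from \<open>A\<close> to \<open>G\<close>.\<close>

definition hom_weight :: "('a \<times> 'a) set \<Rightarrow> ('b \<times> 'b \<Rightarrow> real) \<Rightarrow> ('a \<Rightarrow> 'b) \<Rightarrow> real" where
  "hom_weight A f x = (\<Prod>e\<in>A. f (x (fst e), x (snd e)))"

text \<open>A difference with small cut norm changes homomorphism counts little.  Replace \<open>g\<close> by \<open>f\<close> on one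
  edge after the other; each time the loss is controlled by \<open>cut_bound_in_product\<close>.\<close>

lemma counting_lemma:
  fixes f g :: "'b \<times> 'b \<Rightarrow> real"
  assumes A: "finite A" "A \<subseteq> U \<times> U" "asym A"
    and fin: "finite V" and I: "\<And>w. w \<in> U \<Longrightarrow> I w \<subseteq> V"
    and f: "\<And>z. z \<in> V \<times> V \<Longrightarrow> 0 \<le> f z \<and> f z \<le> 1"
    and g: "\<And>z. z \<in> V \<times> V \<Longrightarrow> 0 \<le> g z \<and> g z \<le> 1"
    and cut: "\<And>S T. S \<subseteq> V \<Longrightarrow> T \<subseteq> V \<Longrightarrow> - c \<le> (\<Sum>z\<in>S \<times> T. f z - g z)"
    and d: "\<And>u v. (u, v) \<in> A \<Longrightarrow> c * real (card (PiE (U - {u} - {v}) I)) \<le> d"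
  shows "(\<Sum>x\<in>PiE U I. hom_weight A g x) - real (card A) * d \<le> (\<Sum>x\<in>PiE U I. hom_weight A f x)"
proof -
  \<comment> \<open>The hybrid between \<open>f\<close> and \<open>g\<close> in which the edges in \<open>B\<close>
    are already replaced.\<close>
  define W where "W B e = (if e \<in> B then f else g)" for B :: "('a \<times> 'a) set" and e
  let ?P = "\<lambda>B (x :: 'a \<Rightarrow> 'b). \<Prod>e\<in>A. W B e (x (fst e), x (snd e))"
  have "(\<Sum>x\<in>PiE U I. hom_weight A g x) - real (card B) * d \<le> (\<Sum>x\<in>PiE U I. ?P B x)"
    if "B \<subseteq> A" for B
    using finite_subset[OF that A(1)] that
  proof (induction B rule: finite_induct)
    case empty
    then show ?case by (simp add: W_def hom_weight_def)
  next
    case (insert e B)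
    obtain u v where e: "e = (u, v)" by (cases e)
    have uv: "(u, v) \<in> A" using insert.prems e by auto
    have Wf: "W (insert e B) e = f" and Wg: "W B e = g"
      using insert.hyps by (simp_all add: W_def)
    let ?Q = "\<lambda>x :: 'a \<Rightarrow> 'b. \<Prod>e'\<in>A - {e}. W B e' (x (fst e'), x (snd e'))"
    have "- d \<le> - c * real (card (PiE (U - {u} - {v}) I))"
      using d[OF uv] by simp
    also have "\<dots> \<le> (\<Sum>x\<in>PiE U I. (f (x u, x v) - g (x u, x v)) * ?Q x)"
      unfolding e
      by (rule cut_bound_in_product[OF A uv fin I, where h = "\<lambda>z. f z - g z"])
        (use f g cut in \<open>auto simp: W_def\<close>)
    also have "\<dots> = (\<Sum>x\<in>PiE U I. ?P (insert e B) x - ?P B x)"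
    proof (rule sum.cong[OF refl])
      fix x :: "'a \<Rightarrow> 'b"
      have "?P (insert e B) x = f (x u, x v) * (\<Prod>e'\<in>A - {e}. W (insert e B) e' (x (fst e'), x (snd e')))"
        using prod.remove[OF A(1) uv, of "\<lambda>e'. W (insert e B) e' (x (fst e'), x (snd e'))"] Wf
        by (simp add: e)
      moreover have "(\<Prod>e'\<in>A - {e}. W (insert e B) e' (x (fst e'), x (snd e'))) = ?Q x"
        by (rule prod.cong) (auto simp: W_def)
      moreover have "?P B x = g (x u, x v) * ?Q x"
        using prod.remove[OF A(1) uv, of "\<lambda>e'. W B e' (x (fst e'), x (snd e'))"] Wg
        by (simp add: e)
      ultimately show "(f (x u, x v) - g (x u, x v)) * ?Q x = ?P (insert e B) x - ?P B x"
        by (simp add: algebra_simps)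
    qed
    finally have "- d \<le> (\<Sum>x\<in>PiE U I. ?P (insert e B) x) - (\<Sum>x\<in>PiE U I. ?P B x)"
      by (simp add: sum_subtractf)
    then show ?case
      using insert.IH insert.prems insert.hyps by (simp add: algebra_simps)
  qed
  from this[OF order_refl] show ?thesis by (simp add: W_def hom_weight_def)
qed

text \<open>Here \<open>g'\<close> is bounded below and \<open>g\<close> is close to it in square mean on the relevant boxes.  For most
  maps \<open>x\<close>, the function \<open>g\<close> is then at least \<open>\<delta> / 2\<close> at the images of all edges simultaneously.\<close>

lemma hom_weight_structured_ge:
  fixes g g' :: "'b \<times> 'b \<Rightarrow> real"
  assumes A: "finite A" "A \<subseteq> U \<times> U" "asym A"
    and "0 < \<delta>" and \<rho>: "8 * real (card A) * \<rho> \<le> \<delta>\<^sup>2"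
    and dense: "\<And>u v z. (u, v) \<in> A \<Longrightarrow> z \<in> I u \<times> I v \<Longrightarrow> \<delta> \<le> g' z"
    and nonneg: "\<And>u v z. (u, v) \<in> A \<Longrightarrow> z \<in> I u \<times> I v \<Longrightarrow> 0 \<le> g z"
    and close: "\<And>u v. (u, v) \<in> A \<Longrightarrow>
      (\<Sum>z\<in>I u \<times> I v. (g z - g' z)\<^sup>2) \<le> \<rho> * real (card (I u \<times> I v))"
  shows "(\<delta> / 2) ^ card A / 2 * real (card (PiE U I)) \<le> (\<Sum>x\<in>PiE U I. hom_weight A g x)"
proof -
  let ?d = "\<lambda>e (x :: 'a \<Rightarrow> 'b). (g (x (fst e), x (snd e)) - g' (x (fst e), x (snd e)))\<^sup>2"
  \<comment> \<open>If the deviation exceeds \<open>\<delta> / 2\<close> at some edge, then the left side is at most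
    0; otherwise all factors on the right are at least \<open>\<delta> / 2\<close>.\<close>
  have pointwise: "(\<delta> / 2) ^ card A * (1 - (\<Sum>e\<in>A. 4 / \<delta>\<^sup>2 * ?d e x)) \<le> hom_weight A g x"
    if x: "x \<in> PiE U I" for x
  proof -
    have mem: "(x (fst e), x (snd e)) \<in> I (fst e) \<times> I (snd e)" if "e \<in> A" for e
      using that x A(2) by (cases e) (auto simp: PiE_def Pi_def)
    have g0: "0 \<le> g (x (fst e), x (snd e))" if "e \<in> A" for e
      using nonneg[of "fst e" "snd e"] mem[OF that] that by simp
    show ?thesis
    proof (cases "\<exists>e\<in>A. 1 < 4 / \<delta>\<^sup>2 * ?d e x")
      case True
      then obtain e where e: "e \<in> A" "1 < 4 / \<delta>\<^sup>2 * ?d e x" by blast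
      have "4 / \<delta>\<^sup>2 * ?d e x \<le> (\<Sum>e\<in>A. 4 / \<delta>\<^sup>2 * ?d e x)"
        using A(1) e(1) by (intro member_le_sum) auto
      then have "1 - (\<Sum>e\<in>A. 4 / \<delta>\<^sup>2 * ?d e x) \<le> 0"
        using e(2) by linarith
      then have "(\<delta> / 2) ^ card A * (1 - (\<Sum>e\<in>A. 4 / \<delta>\<^sup>2 * ?d e x)) \<le> 0"
        using \<open>0 < \<delta>\<close> by (intro mult_nonneg_nonpos) simp_all
      also have "0 \<le> hom_weight A g x"
        unfolding hom_weight_def using g0 by (intro prod_nonneg) auto
      finally show ?thesis .
    next
      case False
      have ge: "\<delta> / 2 \<le> g (x (fst e), x (snd e))" if e: "e \<in> A" for e
      proof -
        have "4 / \<delta>\<^sup>2 * ?d e x \<le> 1" using False e by auto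
        then have "?d e x \<le> (\<delta> / 2)\<^sup>2"
          using \<open>0 < \<delta>\<close> by (simp add: divide_simps power2_eq_square)
        then have "\<bar>g (x (fst e), x (snd e)) - g' (x (fst e), x (snd e))\<bar> \<le> \<delta> / 2"
          using \<open>0 < \<delta>\<close> abs_le_square_iff[of _ "\<delta> / 2"] by simp
        moreover have "\<delta> \<le> g' (x (fst e), x (snd e))"
          using dense[OF _ mem[OF e]] e by simp
        ultimately show ?thesis by linarith
      qed
      have "(\<delta> / 2) ^ card A * (1 - (\<Sum>e\<in>A. 4 / \<delta>\<^sup>2 * ?d e x)) \<le> (\<delta> / 2) ^ card A * 1"
        using \<open>0 < \<delta>\<close> by (intro mult_left_mono) (auto intro!: sum_nonneg)
      also have "\<dots> = (\<Prod>e\<in>A. \<delta> / 2)" by simp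
      also have "\<dots> \<le> hom_weight A g x"
        unfolding hom_weight_def using ge \<open>0 < \<delta>\<close> by (intro prod_mono) auto
      finally show ?thesis .
    qed
  qed
  let ?N = "real (card (PiE U I))"
  have error: "(\<Sum>x\<in>PiE U I. ?d e x) \<le> \<rho> * ?N" if e: "e \<in> A" for e
  proof -
    obtain u v where uv: "e = (u, v)" by (cases e)
    have *: "u \<in> U" "v \<in> U" "u \<noteq> v" using e uv A by (auto dest: asymD)
    have "(\<Sum>x\<in>PiE U I. ?d e x)
        = real (card (PiE (U - {u} - {v}) I)) * (\<Sum>z\<in>I u \<times> I v. (g z - g' z)\<^sup>2)"
      using sum_PiE_marginal[OF *, of "\<lambda>z. (g z - g' z)\<^sup>2" I] by (simp add: uv)
    also have "\<dots> \<le> real (card (PiE (U - {u} - {v}) I)) * (\<rho> * real (card (I u \<times> I v)))"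
      using close e uv by (intro mult_left_mono) auto
    also have "\<dots> = \<rho> * ?N"
      unfolding card_PiE_split[OF *, of I] by simp
    finally show ?thesis .
  qed
  have "(\<Sum>x\<in>PiE U I. \<Sum>e\<in>A. 4 / \<delta>\<^sup>2 * ?d e x) = (\<Sum>e\<in>A. 4 / \<delta>\<^sup>2 * (\<Sum>x\<in>PiE U I. ?d e x))"
    by (subst sum.swap) (simp add: sum_distrib_left)
  also have "\<dots> \<le> (\<Sum>e\<in>A. 4 / \<delta>\<^sup>2 * (\<rho> * ?N))"
    using error by (intro sum_mono mult_left_mono) auto
  also have "\<dots> = (8 * real (card A) * \<rho>) / (2 * \<delta>\<^sup>2) * ?N"
    by simp
  also have "\<dots> \<le> \<delta>\<^sup>2 / (2 * \<delta>\<^sup>2) * ?N"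
    using \<rho> by (intro mult_right_mono divide_right_mono) auto
  also have "\<dots> = ?N / 2" using \<open>0 < \<delta>\<close> by simp
  finally have "?N / 2 \<le> (\<Sum>x\<in>PiE U I. 1 - (\<Sum>e\<in>A. 4 / \<delta>\<^sup>2 * ?d e x))"
    by (simp add: sum_subtractf)
  then have "(\<delta> / 2) ^ card A * (?N / 2)
      \<le> (\<delta> / 2) ^ card A * (\<Sum>x\<in>PiE U I. 1 - (\<Sum>e\<in>A. 4 / \<delta>\<^sup>2 * ?d e x))"
    using \<open>0 < \<delta>\<close> by (intro mult_left_mono) auto
  also have "\<dots> \<le> (\<Sum>x\<in>PiE U I. hom_weight A g x)"
    unfolding sum_distrib_left by (rule sum_mono) (rule pointwise)
  finally show ?thesis by simp
qed

section \<open>The removal lemma\<close>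

lemma cell_profile2: "cell (V \<times> V) (profile2 As) (x, y) = cell V (profile As) x \<times> cell V (profile As) y"
  by (auto simp: cell_def profile2_def)

text \<open>This and the next two lemmas bound the three kinds of edges that are deleted in the proof of the
  removal lemma: those at a small cell, those in a sparse pair of cells, and those in a pair of cells on
  which the fine densities deviate too much from the coarse ones.\<close>

lemma card_in_small_cells:
  assumes fin: "finite V" and "0 \<le> t"
  shows "real (card {x \<in> V. real (card (cell V p x)) < t}) \<le> real (card (p ` V)) * t"
proof -
  let ?S = "{x \<in> V. real (card (cell V p x)) < t}"
  have "real (card ?S) = (\<Sum>x\<in>?S. 1)" by simp
  also have "\<dots> = (\<Sum>l\<in>p ` ?S. \<Sum>x\<in>{x \<in> ?S. p x = l}. 1)"
    by (rule sum.image_gen) (use fin in auto)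
  also have "\<dots> \<le> (\<Sum>l\<in>p ` ?S. t)"
  proof (rule sum_mono)
    fix l assume "l \<in> p ` ?S"
    then obtain z where z: "z \<in> ?S" "l = p z" by blast
    have "real (card {x \<in> ?S. p x = l}) \<le> real (card (cell V p z))"
      unfolding of_nat_le_iff by (rule card_mono) (use fin z in \<open>auto simp: cell_def\<close>)
    also have "\<dots> \<le> t" using z by simp
    finally show "(\<Sum>x\<in>{x \<in> ?S. p x = l}. 1) \<le> t" by simp
  qed
  also have "\<dots> = real (card (p ` ?S)) * t" by simp
  also have "\<dots> \<le> real (card (p ` V)) * t"
    using \<open>0 \<le> t\<close> fin by (intro mult_right_mono) (auto intro!: card_mono)
  finally show ?thesis .
qed

lemma card_low_density:
  assumes fin: "finite X" and G: "G \<subseteq> X" and "0 \<le> \<delta>"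
  shows "real (card {z \<in> G. cexp X p (\<lambda>z. of_bool (z \<in> G)) z < \<delta>}) \<le> \<delta> * real (card X)"
proof -
  let ?f = "\<lambda>z. of_bool (z \<in> G) :: real"
  let ?low = "\<lambda>z. of_bool (cexp X p ?f z < \<delta>) :: real"
  have "{z \<in> G. cexp X p ?f z < \<delta>} = {z \<in> X. z \<in> G \<and> cexp X p ?f z < \<delta>}"
    using G by blast
  then have "real (card {z \<in> G. cexp X p ?f z < \<delta>}) = (\<Sum>z\<in>{z \<in> X. z \<in> G \<and> cexp X p ?f z < \<delta>}. 1)"
    by simp
  also have "\<dots> = (\<Sum>z\<in>X. if z \<in> G \<and> cexp X p ?f z < \<delta> then 1 else 0)"
    by (rule sum.inter_filter[OF fin])
  also have "\<dots> = (\<Sum>z\<in>X. ?f z * ?low z)"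
    by (rule sum.cong) auto
  also have "\<dots> = (\<Sum>z\<in>X. cexp X p ?f z * ?low z)"
  proof (rule sum_cexp_mult[OF fin, symmetric])
    fix x y :: 'a assume "p x = p y"
    then have "cexp X p ?f x = cexp X p ?f y" by (rule cexp_cong)
    then show "?low x = ?low y" by simp
  qed
  also have "\<dots> \<le> (\<Sum>z\<in>X. \<delta>)"
    using \<open>0 \<le> \<delta>\<close> by (intro sum_mono) auto
  finally show ?thesis by (simp add: mult.commute)
qed

lemma card_large_cexp:
  assumes fin: "finite X" and d: "\<And>z. 0 \<le> d z" and "0 < \<rho>"
    and total: "(\<Sum>z\<in>X. d z) \<le> \<delta> * \<rho> * N"
  shows "real (card {z \<in> X. \<rho> < cexp X p d z}) \<le> \<delta> * N"
proof -
  have "\<rho> * real (card {z \<in> X. \<rho> < cexp X p d z}) = (\<Sum>z\<in>{z \<in> X. \<rho> < cexp X p d z}. \<rho>)"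
    by simp
  also have "\<dots> \<le> (\<Sum>z\<in>{z \<in> X. \<rho> < cexp X p d z}. cexp X p d z)"
    by (rule sum_mono) simp
  also have "\<dots> \<le> (\<Sum>z\<in>X. cexp X p d z)"
    by (rule sum_mono2) (use fin d in \<open>auto intro: cexp_nonneg\<close>)
  also have "\<dots> \<le> \<rho> * (\<delta> * N)"
    using total by (simp add: sum_cexp[OF fin] mult_ac)
  finally show ?thesis using \<open>0 < \<rho>\<close> by simp
qed

text \<open>The graph removal lemma, for homomorphisms of an oriented graph \<open>A\<close> on \<open>U\<close>; the orientation
  gives every edge a first and a second end.  The set \<open>D\<close> is read off from a regular pair of
  partitions for \<open>G\<close>.  If there is a homomorphism into \<open>G - D\<close>, then the cells of its values at
  non-isolated vertices are large, and every edge is mapped into a dense block on which the fine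
  densities are close to the coarse ones.  Among the maps into these cells there are then enough
  homomorphisms into \<open>G\<close> to make up a positive proportion of all maps from \<open>U\<close> to \<open>V\<close>.\<close>

theorem removal_lemma:
  fixes U :: "'a set" and A :: "('a \<times> 'a) set"
  assumes finU: "finite U" and A: "A \<subseteq> U \<times> U" "asym A" and "0 < \<epsilon>"
  obtains c where "0 < c" "\<forall>(V :: 'b set) G. finite V \<and> G \<subseteq> V \<times> V \<longrightarrow>
    c * real (card V) ^ card U \<le> real (card {x \<in> PiE U (\<lambda>_. V). \<forall>(s, t)\<in>A. (x s, x t) \<in> G}) \<or>
    (\<exists>D\<subseteq>G. real (card D) \<le> \<epsilon> * (real (card V))\<^sup>2 \<and>
      (\<forall>x\<in>PiE U (\<lambda>_. V). \<exists>(s, t)\<in>A. (x s, x t) \<notin> G - D))"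
proof -
  have finA: "finite A" using A(1) finU by (meson finite_SigmaI finite_subset)
  define k where "k = card U"
  define e where "e = card A"
  define \<delta> where "\<delta> = min (\<epsilon> / 4) 1"
  have \<delta>: "0 < \<delta>" "\<delta> \<le> 1" "4 * \<delta> \<le> \<epsilon>" using \<open>0 < \<epsilon>\<close> by (auto simp: \<delta>_def)
  \<comment> \<open>Small enough for \<open>hom_weight_structured_ge\<close>; adding 1 avoids a division by 0 when
    \<open>A\<close> is empty.\<close>
  define \<rho> where "\<rho> = \<delta>\<^sup>2 / (8 * (real e + 1))"
  have \<rho>: "0 < \<rho>" "8 * real (card A) * \<rho> \<le> \<delta>\<^sup>2"
    using \<delta>(1) by (auto simp: \<rho>_def e_def field_simps)
  \<comment> \<open>Half of the structured count, in units of \<open>n ^ k\<close>, when \<open>m\<close> sets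
    generate the partition; this leaves the other half for the cut-norm error.\<close>
  define c where "c m = (\<delta> / 2) ^ e * (\<delta> / 2 ^ m) ^ k / 4" for m :: nat
  have c_pos: "0 < c m" for m using \<delta>(1) by (simp add: c_def)
  define \<eta> where "\<eta> m = c m / (real e + 1)" for m
  have \<eta>: "0 < \<eta> m" for m using c_pos by (simp add: \<eta>_def)
  obtain K where K: "\<forall>(V :: 'b set) f. finite V \<and> (\<forall>z\<in>V \<times> V. 0 \<le> f z \<and> f z \<le> 1) \<longrightarrow>
    (\<exists>As Bs. length As \<le> K \<and> cut_regular V f (As @ Bs) (\<eta> (length As)) \<and>
      energy (V \<times> V) (profile2 (As @ Bs)) f
        \<le> energy (V \<times> V) (profile2 As) f + \<delta> * \<rho> * real (card (V \<times> V)))"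
    by (rule strong_regularity[of "\<delta> * \<rho>" \<eta>, OF mult_pos_pos[OF \<delta>(1) \<rho>(1)] \<eta>])
  have "c K * real (card V) ^ k \<le> real (card {x \<in> PiE U (\<lambda>_. V). \<forall>(s, t)\<in>A. (x s, x t) \<in> G}) \<or>
    (\<exists>D\<subseteq>G. real (card D) \<le> \<epsilon> * (real (card V))\<^sup>2 \<and>
      (\<forall>x\<in>PiE U (\<lambda>_. V). \<exists>(s, t)\<in>A. (x s, x t) \<notin> G - D))"
    if fin: "finite V" and G: "G \<subseteq> V \<times> V" for V :: "'b set" and G
  proof -
    define n where "n = real (card V)"
    define f where "f z = (of_bool (z \<in> G) :: real)" for z
    let ?X = "V \<times> V"
    have finX: "finite ?X" and N: "real (card ?X) = n\<^sup>2"
      using fin by (auto simp: n_def power2_eq_square)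
    have f01: "0 \<le> f z" "f z \<le> 1" for z by (auto simp: f_def)
    obtain As Bs where AB: "length As \<le> K" "cut_regular V f (As @ Bs) (\<eta> (length As))"
        "energy ?X (profile2 (As @ Bs)) f \<le> energy ?X (profile2 As) f + \<delta> * \<rho> * real (card ?X)"
      using K[rule_format, of V f] fin f01 by blast
    define m where "m = length As"
    define \<tau> where "\<tau> = \<delta> / 2 ^ m"
    have "\<delta> \<le> 1 * 2 ^ m" using \<delta>(2) by (rule order_trans) simp
    then have \<tau>: "0 < \<tau>" "\<tau> \<le> 1" using \<delta>(1) by (auto simp: \<tau>_def divide_simps)
    define gA where "gA = cexp ?X (profile2 As) f"
    define gB where "gB = cexp ?X (profile2 (As @ Bs)) f"
    define d2 where "d2 z = (gB z - gA z)\<^sup>2" for z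
    define cV where "cV = cell V (profile As)"
    \<comment> \<open>Edges in sparse blocks, pairs in irregular blocks, and vertices in small cells; each of the four
      parts of \<open>D\<close> has at most \<open>\<delta> n\<^sup>2\<close> elements.\<close>
    define D1 where "D1 = {z \<in> G. gA z < \<delta>}"
    define D2 where "D2 = {z \<in> ?X. \<rho> < cexp ?X (profile2 As) d2 z}"
    define Sm where "Sm = {x \<in> V. real (card (cV x)) < \<tau> * n}"
    define D where "D = G \<inter> (D1 \<union> D2 \<union> Sm \<times> V \<union> V \<times> Sm)"
    have fins: "finite D1" "finite D2" "finite Sm"
      using fin finite_subset[OF G finX] by (auto simp: D1_def D2_def Sm_def)
    have card_D: "real (card D) \<le> \<epsilon> * n\<^sup>2"
    proof -
      have b1: "real (card D1) \<le> \<delta> * n\<^sup>2"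
        unfolding D1_def gA_def f_def N[symmetric]
        by (rule card_low_density[OF finX G]) (use \<delta> in auto)
      have "(\<Sum>z\<in>?X. d2 z) = energy ?X (profile2 (As @ Bs)) f - energy ?X (profile2 As) f"
        unfolding d2_def gA_def gB_def by (rule energy_increment[OF finX]) (rule profile2_append)
      also have "\<dots> \<le> \<delta> * \<rho> * n\<^sup>2" using AB(3) N by simp
      finally have "(\<Sum>z\<in>?X. d2 z) \<le> \<delta> * \<rho> * n\<^sup>2" .
      then have b2: "real (card D2) \<le> \<delta> * n\<^sup>2"
        unfolding D2_def by (intro card_large_cexp[OF finX _ \<rho>(1)]) (auto simp: d2_def)
      have "real (card Sm) \<le> real (card (profile As ` V)) * (\<tau> * n)"
        unfolding Sm_def cV_def by (rule card_in_small_cells[OF fin]) (use \<tau> in \<open>auto simp: n_def\<close>)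
      also have "\<dots> \<le> 2 ^ m * (\<tau> * n)"
      proof (rule mult_right_mono)
        have "real (card (profile As ` V)) \<le> real (2 ^ m)"
          unfolding of_nat_le_iff m_def by (rule card_profile_image)
        then show "real (card (profile As ` V)) \<le> 2 ^ m" by simp
      qed (use \<tau> in \<open>auto simp: n_def\<close>)
      also have "\<dots> = \<delta> * n" by (simp add: \<tau>_def)
      finally have "real (card Sm) * n \<le> \<delta> * n * n"
        by (rule mult_right_mono) (simp add: n_def)
      then have b3: "real (card (Sm \<times> V)) \<le> \<delta> * n\<^sup>2" "real (card (V \<times> Sm)) \<le> \<delta> * n\<^sup>2"
        by (simp_all add: card_cartesian_product n_def power2_eq_square mult_ac)
      have "card D \<le> card (D1 \<union> D2 \<union> Sm \<times> V \<union> V \<times> Sm)"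
        unfolding D_def using fins fin by (intro card_mono) auto
      also have "\<dots> \<le> card D1 + card D2 + card (Sm \<times> V) + card (V \<times> Sm)"
        by (meson add_le_mono card_Un_le le_trans order_refl)
      finally have "real (card D) \<le> real (card D1) + real (card D2) + real (card (Sm \<times> V)) + real (card (V \<times> Sm))"
        by linarith
      also have "\<dots> \<le> (4 * \<delta>) * n\<^sup>2" using b1 b2 b3 by linarith
      also have "\<dots> \<le> \<epsilon> * n\<^sup>2" using \<delta>(3) by (rule mult_right_mono) simp
      finally show ?thesis .
    qed
    have count: "c K * n ^ k \<le> real (card {x \<in> PiE U (\<lambda>_. V). \<forall>(s, t)\<in>A. (x s, x t) \<in> G})"
      if x: "x \<in> PiE U (\<lambda>_. V)" and hom: "\<And>s t. (s, t) \<in> A \<Longrightarrow> (x s, x t) \<in> G - D" for x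
    proof -
      \<comment> \<open>An isolated vertex of the pattern is unconstrained, and its cell might be small.\<close>
      define I where "I u = (if u \<in> Field A then cV (x u) else V)" for u
      have xV: "x u \<in> V" if "u \<in> U" for u using x that by auto
      have IV: "I u \<subseteq> V" for u by (auto simp: I_def cV_def cell_def)
      have I_cell: "I u \<times> I v = cell ?X (profile2 As) (x u, x v)" if "(u, v) \<in> A" for u v
        using that by (auto simp: I_def cV_def cell_profile2 Field_def)
      have good: "\<delta> \<le> gA (x u, x v)" "cexp ?X (profile2 As) d2 (x u, x v) \<le> \<rho>"
          "x u \<notin> Sm" "x v \<notin> Sm" if uv: "(u, v) \<in> A" for u v
        using hom[OF uv] xV A(1) uv by (auto simp: D_def D1_def D2_def not_less)
      have large: "\<tau> * n \<le> real (card (I u))" if u: "u \<in> U" for u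
      proof (cases "u \<in> Field A")
        case True
        then have "x u \<notin> Sm" using good by (auto simp: Field_def)
        then show ?thesis using True xV[OF u] by (simp add: I_def Sm_def)
      next
        case False
        have "\<tau> * n \<le> 1 * n" using \<tau>(2) by (rule mult_right_mono) (simp add: n_def)
        then show ?thesis using False by (simp add: I_def n_def)
      qed
      have PiE_large: "(\<tau> * n) ^ k \<le> real (card (PiE U I))"
      proof -
        have "(\<tau> * n) ^ k = (\<Prod>u\<in>U. \<tau> * n)" by (simp add: k_def)
        also have "\<dots> \<le> (\<Prod>u\<in>U. real (card (I u)))"
          using large \<tau>(1) by (intro prod_mono) (auto simp: n_def)
        also have "\<dots> = real (card (PiE U I))" by (simp add: card_PiE[OF finU])
        finally show ?thesis .
      qed
      have B01: "0 \<le> gB z \<and> gB z \<le> 1" if "z \<in> ?X" for z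
        unfolding gB_def by (intro conjI cexp_nonneg cexp_le_1[OF finX that] f01)
      have A1: "\<delta> \<le> gA z" if uv: "(u, v) \<in> A" and z: "z \<in> I u \<times> I v" for u v z
      proof -
        have "profile2 As z = profile2 As (x u, x v)"
          using z unfolding I_cell[OF uv] by (simp add: cell_def)
        then have "gA z = gA (x u, x v)" unfolding gA_def by (rule cexp_cong)
        then show ?thesis using good(1)[OF uv] by simp
      qed
      have A2: "(\<Sum>z\<in>I u \<times> I v. (gB z - gA z)\<^sup>2) \<le> \<rho> * real (card (I u \<times> I v))"
        if uv: "(u, v) \<in> A" for u v
      proof -
        have "(x u, x v) \<in> ?X" using xV A(1) uv by auto
        then have "(\<Sum>z\<in>I u \<times> I v. d2 z)
            = cexp ?X (profile2 As) d2 (x u, x v) * real (card (I u \<times> I v))"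
          unfolding I_cell[OF uv] by (rule cexp_times_card[OF finX, symmetric])
        also have "\<dots> \<le> \<rho> * real (card (I u \<times> I v))"
          using good(2)[OF uv] by (rule mult_right_mono) simp
        finally show ?thesis by (simp add: d2_def)
      qed
      have main: "(\<delta> / 2) ^ e / 2 * real (card (PiE U I)) \<le> (\<Sum>x\<in>PiE U I. hom_weight A gB x)"
        unfolding e_def
      proof (rule hom_weight_structured_ge[OF finA A \<delta>(1) \<rho>(2) A1 _ A2])
        show "0 \<le> gB z" if "z \<in> I u \<times> I v" for u v z using that IV B01 by blast
      qed
      have err: "(\<Sum>x\<in>PiE U I. hom_weight A gB x) - real (card A) * (\<eta> m * n ^ k)
          \<le> (\<Sum>x\<in>PiE U I. hom_weight A f x)"
      proof (rule counting_lemma[OF finA A fin IV, where c = "\<eta> m * n\<^sup>2"])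
        show "- (\<eta> m * n\<^sup>2) \<le> (\<Sum>z\<in>S \<times> T. f z - gB z)" if "S \<subseteq> V" "T \<subseteq> V" for S T
        proof -
          have "\<bar>\<Sum>z\<in>S \<times> T. f z - gB z\<bar> \<le> \<eta> m * n\<^sup>2"
            using AB(2) that unfolding cut_regular_def m_def gB_def N by blast
          then show ?thesis by linarith
        qed
        show "\<eta> m * n\<^sup>2 * real (card (PiE (U - {u} - {v}) I)) \<le> \<eta> m * n ^ k" if uv: "(u, v) \<in> A" for u v
        proof -
          have *: "u \<in> U" "v \<in> U" "u \<noteq> v" using A uv by (auto dest: asymD)
          have "card (U - {u} - {v}) + 2 = k"
            using * finU card_Suc_Diff1[of U u] card_Suc_Diff1[of "U - {u}" v] by (auto simp: k_def)
          then have k: "n\<^sup>2 * n ^ card (U - {u} - {v}) = n ^ k"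
            by (metis add.commute power_add)
          have "real (card (PiE (U - {u} - {v}) I)) = (\<Prod>w\<in>U - {u} - {v}. real (card (I w)))"
            using finU by (simp add: card_PiE)
          also have "\<dots> \<le> (\<Prod>w\<in>U - {u} - {v}. n)"
            using IV fin by (intro prod_mono) (auto simp: n_def intro: card_mono)
          also have "\<dots> = n ^ card (U - {u} - {v})" by simp
          finally have "\<eta> m * n\<^sup>2 * real (card (PiE (U - {u} - {v}) I)) \<le> \<eta> m * n\<^sup>2 * n ^ card (U - {u} - {v})"
            using \<eta>[of m] by (intro mult_left_mono) auto
          then show ?thesis using k by (simp add: mult.assoc)
        qed
      qed (use f01 B01 in auto)
      have f_count: "hom_weight A f y = of_bool (\<forall>(s, t)\<in>A. (y s, y t) \<in> G)" for y
      proof (cases "\<forall>(s, t)\<in>A. (y s, y t) \<in> G")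
        case True
        then have "hom_weight A f y = 1" unfolding hom_weight_def by (intro prod.neutral) (auto simp: f_def)
        then show ?thesis using True by simp
      next
        case False
        then obtain s t where "(s, t) \<in> A" "(y s, y t) \<notin> G" by blast
        then have "hom_weight A f y = 0"
          unfolding hom_weight_def using finA by (intro prod_zero) (auto simp: f_def intro!: bexI[of _ "(s, t)"])
        then show ?thesis using False by simp
      qed
      have finP: "finite (PiE U (\<lambda>_. V))" using finU fin by (intro finite_PiE) auto
      have "(\<Sum>x\<in>PiE U I. hom_weight A f x) \<le> (\<Sum>x\<in>PiE U (\<lambda>_. V). hom_weight A f x)"
      proof (rule sum_mono2[OF finP])
        show "PiE U I \<subseteq> PiE U (\<lambda>_. V)" by (rule PiE_mono) (rule IV)
      qed (simp add: f_count)
      also have "\<dots> = (\<Sum>y\<in>PiE U (\<lambda>_. V). if \<forall>(s, t)\<in>A. (y s, y t) \<in> G then 1 else 0)"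
        by (rule sum.cong) (auto simp: f_count)
      also have "\<dots> = real (card {x \<in> PiE U (\<lambda>_. V). \<forall>(s, t)\<in>A. (x s, x t) \<in> G})"
        using sum.inter_filter[OF finP, of "\<lambda>_. 1::real" "\<lambda>y. \<forall>(s, t)\<in>A. (y s, y t) \<in> G"] by simp
      finally have up: "(\<Sum>x\<in>PiE U I. hom_weight A f x)
          \<le> real (card {x \<in> PiE U (\<lambda>_. V). \<forall>(s, t)\<in>A. (x s, x t) \<in> G})" .
      have "(\<delta> / 2) ^ e / 2 * (\<tau> * n) ^ k \<le> (\<delta> / 2) ^ e / 2 * real (card (PiE U I))"
        using PiE_large \<delta>(1) by (intro mult_left_mono) auto
      moreover have "(\<delta> / 2) ^ e / 2 * (\<tau> * n) ^ k = 2 * (c m * n ^ k)"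
      proof -
        have "c m = (\<delta> / 2) ^ e * \<tau> ^ k / 4" by (simp add: c_def \<tau>_def)
        then show ?thesis by (simp add: power_mult_distrib)
      qed
      moreover have "real (card A) * (\<eta> m * n ^ k) \<le> c m * n ^ k"
      proof -
        have "real e * \<eta> m \<le> c m" using c_pos[of m] by (simp add: \<eta>_def field_simps)
        then have "real e * \<eta> m * n ^ k \<le> c m * n ^ k"
          by (rule mult_right_mono) (simp add: n_def)
        then show ?thesis by (simp add: e_def mult.assoc)
      qed
      ultimately have "c m * n ^ k \<le> real (card {x \<in> PiE U (\<lambda>_. V). \<forall>(s, t)\<in>A. (x s, x t) \<in> G})"
        using main err up by linarith
      moreover have "c K * n ^ k \<le> c m * n ^ k"
      proof (rule mult_right_mono)
        have "(2::real) ^ m \<le> 2 ^ K" using AB(1) by (intro power_increasing) (auto simp: m_def)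
        then have "\<delta> / 2 ^ K \<le> \<delta> / 2 ^ m" using \<delta>(1) by (intro divide_left_mono) auto
        then have "(\<delta> / 2 ^ K) ^ k \<le> (\<delta> / 2 ^ m) ^ k" using \<delta>(1) by (intro power_mono) auto
        then show "c K \<le> c m"
          unfolding c_def using \<delta>(1) by (intro divide_right_mono mult_left_mono) auto
      qed (simp add: n_def)
      ultimately show ?thesis by linarith
    qed
    have DG: "D \<subseteq> G" by (simp add: D_def)
    show ?thesis
    proof (cases "\<exists>x\<in>PiE U (\<lambda>_. V). \<forall>(s, t)\<in>A. (x s, x t) \<in> G - D")
      case True
      then obtain x where x: "x \<in> PiE U (\<lambda>_. V)" "\<forall>(s, t)\<in>A. (x s, x t) \<in> G - D" by blast
      have "c K * n ^ k \<le> real (card {x \<in> PiE U (\<lambda>_. V). \<forall>(s, t)\<in>A. (x s, x t) \<in> G})"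
        by (rule count[OF x(1)]) (use x(2) in auto)
      then show ?thesis unfolding n_def ..
    next
      case False
      then have "\<forall>x\<in>PiE U (\<lambda>_. V). \<exists>(s, t)\<in>A. (x s, x t) \<notin> G - D" by fastforce
      then show ?thesis using DG card_D unfolding n_def by (intro disjI2 exI[of _ D] conjI)
    qed
  qed
  then show ?thesis
    by (intro that[of "c K"]) (simp_all add: c_pos k_def)
qed

section \<open>Berge copies and Ramsey colourings\<close>

text \<open>Edges of \<open>F\<close> are oriented along an injection of the vertices into the natural numbers.\<close>

lemma graph_orientation:
  assumes "graph F"
  obtains A where "A \<subseteq> verts F \<times> verts F" "asym A"
    "\<And>u v. (u, v) \<in> A \<Longrightarrow> {u, v} \<in> edges F"
    "\<And>d. d \<in> edges F \<Longrightarrow> \<exists>u v. (u, v) \<in> A \<and> d = {u, v}"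
proof -
  have fin: "finite (verts F)" using assms by (simp add: graph_def)
  obtain r :: "'a \<Rightarrow> nat" where r: "inj_on r (verts F)"
    using finite_imp_inj_to_nat_seg[OF fin] by blast
  define A where "A = {(u, v). {u, v} \<in> edges F \<and> u \<in> verts F \<and> v \<in> verts F \<and> r u < r v}"
  show ?thesis
  proof (rule that[of A])
    show "asym A" by (auto simp: A_def intro!: asymI)
    show "\<exists>u v. (u, v) \<in> A \<and> d = {u, v}" if d: "d \<in> edges F" for d
    proof -
      have "d \<in> [verts F]\<^bsup>2\<^esup>" using assms d by (auto simp: graph_def)
      then obtain x y where xy: "d = {x, y}" "x \<noteq> y" "x \<in> verts F" "y \<in> verts F"
        unfolding nsets_def card_2_iff by blast
      then have "r x \<noteq> r y" using r by (auto simp: inj_on_def)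
      then consider "r x < r y" | "r y < r x" by linarith
      then show ?thesis
      proof cases
        case 1
        then have "(x, y) \<in> A" using xy d by (simp add: A_def)
        then show ?thesis using xy(1) by blast
      next
        case 2
        then have "(y, x) \<in> A" using xy d by (simp add: A_def insert_commute)
        then show ?thesis using xy(1) by (metis insert_commute)
      qed
    qed
  qed (auto simp: A_def)
qed

lemma not_Berge_free_witness:
  assumes "hypergraph H" "inj_on \<phi> (verts F)" "\<phi> ` verts F \<subseteq> verts H"
    and "inj_on f (edges F)" "\<And>d. d \<in> edges F \<Longrightarrow> f d \<in> edges H \<and> \<phi> ` d \<subseteq> f d"
  shows "\<not> Berge_free F H"
proof -
  let ?H' = "(verts H, f ` edges F)"
  have "subhypergraph ?H' H"
    using assms(1,5) by (auto simp: subhypergraph_def hypergraph_def)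
  moreover have "Berge F ?H'"
    unfolding Berge_def using assms by (intro exI[of _ \<phi>] exI[of _ f]) (auto simp: bij_betw_def)
  ultimately show ?thesis by (auto simp: Berge_free_def)
qed

text \<open>Each set is so large that it still contains an unused element when all other
  representatives and all of \<open>X\<close> are excluded.\<close>

lemma greedy_distinct_representatives:
  assumes "finite D" "finite X" "\<And>d. d \<in> D \<Longrightarrow> card D + card X \<le> card (S d)"
  shows "\<exists>f. inj_on f D \<and> (\<forall>d\<in>D. f d \<in> S d - X)"
  using assms
proof (induction D arbitrary: X rule: finite_induct)
  case empty
  then show ?case by simp
next
  case (insert d D)
  have "card X < card (S d)" using insert.prems(2)[of d] insert.hyps by simp
  then have "\<not> S d \<subseteq> X" using insert.prems(1) by (meson card_mono not_le)
  then obtain s where s: "s \<in> S d" "s \<notin> X" by blast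
  have "\<exists>f. inj_on f D \<and> (\<forall>d\<in>D. f d \<in> S d - insert s X)"
  proof (rule insert.IH)
    show "card D + card (insert s X) \<le> card (S d')" if "d' \<in> D" for d'
      using insert.prems(2)[of d'] insert.hyps insert.prems(1) s(2) that by simp
  qed (use insert.prems(1) in simp)
  then obtain f where f: "inj_on f D" "\<forall>d\<in>D. f d \<in> S d - insert s X" by blast
  have "inj_on (f(d := s)) (insert d D)"
    using f insert.hyps(2) by (auto simp: inj_on_def)
  moreover have "\<forall>d'\<in>insert d D. (f(d := s)) d' \<in> S d' - X"
    using f insert.hyps(2) s by auto
  ultimately show ?case by blast
qed

definition codegree :: "'b hgraph \<Rightarrow> 'b set \<Rightarrow> nat" where
  "codegree H d = card {h \<in> edges H. d \<subseteq> h}"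

text \<open>The hyperedge \<open>h\<close> that contains the whole copy represents the missing edge \<open>e\<close>; all other edges
  are in so many hyperedges that the greedy choice succeeds.\<close>

lemma heavy_copy_not_Berge_free:
  assumes F: "graph F" "e \<in> edges F" and H: "hypergraph H" "h \<in> edges H"
    and \<phi>: "inj_on \<phi> (verts F)" "\<phi> ` verts F \<subseteq> h"
    and heavy: "\<And>d. d \<in> edges F - {e} \<Longrightarrow> card (edges F) \<le> codegree H (\<phi> ` d)"
  shows "\<not> Berge_free F H"
proof -
  have sub: "d \<subseteq> verts F" if "d \<in> edges F" for d
    using F(1) that by (auto simp: graph_def nsets_def)
  have finE: "finite (edges F)"
    using F(1) unfolding graph_def by (meson finite_imp_finite_nsets finite_subset)
  have "\<exists>f. inj_on f (edges F - {e}) \<and>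
      (\<forall>d\<in>edges F - {e}. f d \<in> {h \<in> edges H. \<phi> ` d \<subseteq> h} - {h})"
  proof (rule greedy_distinct_representatives)
    show "card (edges F - {e}) + card {h} \<le> card {h \<in> edges H. \<phi> ` d \<subseteq> h}"
      if "d \<in> edges F - {e}" for d
      using heavy[OF that] F(2) finE card_Suc_Diff1[OF finE F(2)] by (simp add: codegree_def)
  qed (use finE in auto)
  then obtain f where f: "inj_on f (edges F - {e})"
      "\<And>d. d \<in> edges F - {e} \<Longrightarrow> f d \<in> edges H \<and> \<phi> ` d \<subseteq> f d \<and> f d \<noteq> h"
    by blast
  show ?thesis
  proof (rule not_Berge_free_witness[OF H(1) \<phi>(1)])
    show "\<phi> ` verts F \<subseteq> verts H"
      using \<phi>(2) H by (auto simp: hypergraph_def)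
    show "inj_on (f(e := h)) (edges F)"
      unfolding inj_on_def
    proof (intro ballI impI)
      fix d d' assume d: "d \<in> edges F" "d' \<in> edges F" "(f(e := h)) d = (f(e := h)) d'"
      show "d = d'"
      proof (cases "d = e \<or> d' = e")
        case True
        then show ?thesis using d f(2)[of d] f(2)[of d'] by (auto split: if_splits)
      next
        case False
        then show ?thesis using d f(1) by (auto simp: inj_on_def)
      qed
    qed
    show "(f(e := h)) d \<in> edges H \<and> \<phi> ` d \<subseteq> (f(e := h)) d" if "d \<in> edges F" for d
      using that f(2)[of d] H(2) \<phi>(2) sub[OF that] by auto
  qed
qed

text \<open>The Ramsey property is stated for colourings of an initial segment of the natural numbers; a bijection
  transports it to any set of the same size.\<close>

lemma ramsey_prop_on_set:
  assumes "ramsey_prop F G N" "finite X" "card X = N" "graph F" "graph G"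
  obtains \<phi> where "inj_on \<phi> (verts F)" "\<phi> ` verts F \<subseteq> X" "\<And>d. d \<in> edges F \<Longrightarrow> c (\<phi> ` d)"
  | \<phi> where "inj_on \<phi> (verts G)" "\<phi> ` verts G \<subseteq> X" "\<And>d. d \<in> edges G \<Longrightarrow> \<not> c (\<phi> ` d)"
proof -
  obtain b where b: "bij_betw b {..<N} X"
    using assms(2,3) by (metis finite_same_card_bij finite_lessThan card_lessThan)
  have pull: "\<exists>\<psi>. inj_on \<psi> (verts K) \<and> \<psi> ` verts K \<subseteq> X \<and> (\<forall>d\<in>edges K. P (\<psi> ` d))"
    if copy: "contains_copy ({..<N}, {e \<in> [{..<N}]\<^bsup>2\<^esup>. P (b ` e)}) K" for K :: "'z hgraph" and P
  proof -
    obtain \<phi> where \<phi>: "inj_on \<phi> (verts K)" "\<phi> ` verts K \<subseteq> {..<N}" "\<forall>d\<in>edges K. P (b ` \<phi> ` d)"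
      using copy unfolding contains_copy_def by auto
    have "inj_on (b \<circ> \<phi>) (verts K)"
      using \<phi>(1,2) b by (meson bij_betw_imp_inj_on comp_inj_on inj_on_subset)
    moreover have "(b \<circ> \<phi>) ` verts K \<subseteq> X"
      using \<phi>(2) bij_betw_imp_surj_on[OF b] by auto
    moreover have "\<forall>d\<in>edges K. P ((b \<circ> \<phi>) ` d)"
      using \<phi>(3) by (simp add: image_comp)
    ultimately show ?thesis by blast
  qed
  have "contains_copy ({..<N}, {e \<in> [{..<N}]\<^bsup>2\<^esup>. c (b ` e)}) F \<or>
        contains_copy ({..<N}, {e \<in> [{..<N}]\<^bsup>2\<^esup>. \<not> c (b ` e)}) G"
    using assms(1)[unfolded ramsey_prop_def, rule_format, of "\<lambda>e. c (b ` e)"] by simp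
  then show ?thesis
  proof
    assume "contains_copy ({..<N}, {e \<in> [{..<N}]\<^bsup>2\<^esup>. c (b ` e)}) F"
    from pull[OF this] show ?thesis using that(1) by blast
  next
    assume "contains_copy ({..<N}, {e \<in> [{..<N}]\<^bsup>2\<^esup>. \<not> c (b ` e)}) G"
    from pull[of "\<lambda>d. \<not> c d", OF this] show ?thesis using that(2) by blast
  qed
qed

text \<open>Double counting: each of the \<open>m choose R\<close> subsets contains a pair in \<open>P\<close>, and each pair is in
  \<open>(m - 2) choose (R - 2)\<close> of the subsets, where \<open>m = card h\<close>.  The quotient of these numbers is
  \<open>m (m - 1) / (R (R - 1))\<close>.\<close>

lemma pairs_hitting_all_subsets:
  fixes P :: "('b \<times> 'b) set"
  assumes fin: "finite h" and R: "2 \<le> R" "R \<le> card h" and P: "P \<subseteq> h \<times> h"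
    and hit: "\<And>X. X \<subseteq> h \<Longrightarrow> card X = R \<Longrightarrow> \<exists>x y. (x, y) \<in> P \<and> x \<in> X \<and> y \<in> X \<and> x \<noteq> y"
  shows "(card h)\<^sup>2 \<le> 2 * R\<^sup>2 * card P"
proof -
  define m where "m = card h"
  define P' where "P' = {p \<in> P. fst p \<noteq> snd p}"
  have "finite P" using finite_subset[OF P] fin by simp
  then have finP: "finite P" "finite P'" by (simp_all add: P'_def)
  define B where "B p = {X. X \<subseteq> h \<and> card X = R \<and> fst p \<in> X \<and> snd p \<in> X}" for p
  have B: "card (B p) \<le> (m - 2) choose (R - 2)" if p: "p \<in> P'" for p
  proof -
    obtain x y where xy: "p = (x, y)" "x \<in> h" "y \<in> h" "x \<noteq> y"
      using p P by (cases p) (auto simp: P'_def)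
    have "card (B p) \<le> card {Y. Y \<subseteq> h - {x, y} \<and> card Y = R - 2}"
    proof (rule card_inj_on_le)
      show "inj_on (\<lambda>X. X - {x, y}) (B p)"
        unfolding inj_on_def B_def xy by auto
      show "(\<lambda>X. X - {x, y}) ` B p \<subseteq> {Y. Y \<subseteq> h - {x, y} \<and> card Y = R - 2}"
      proof (clarify)
        fix X assume "X \<in> B p"
        then have X: "X \<subseteq> h" "card X = R" "x \<in> X" "y \<in> X" by (auto simp: B_def xy)
        have "card (X - {x, y}) = R - 2"
          using X xy(4) by (subst card_Diff_subset) auto
        then show "X - {x, y} \<subseteq> h - {x, y} \<and> card (X - {x, y}) = R - 2" using X by blast
      qed
      show "finite {Y. Y \<subseteq> h - {x, y} \<and> card Y = R - 2}" using fin by simp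
    qed
    also have "\<dots> = card (h - {x, y}) choose (R - 2)"
      using fin by (intro n_subsets) simp
    also have "card (h - {x, y}) = m - 2"
      using xy by (subst card_Diff_subset) (auto simp: m_def)
    finally show ?thesis .
  qed
  have "m choose R = card {X. X \<subseteq> h \<and> card X = R}"
    unfolding m_def by (rule n_subsets[OF fin, symmetric])
  also have "\<dots> \<le> card (\<Union>p\<in>P'. B p)"
  proof (rule card_mono)
    have "finite (B p)" for p using fin by (simp add: B_def)
    then show "finite (\<Union>p\<in>P'. B p)" using finP by blast
    show "{X. X \<subseteq> h \<and> card X = R} \<subseteq> (\<Union>p\<in>P'. B p)"
    proof
      fix X assume "X \<in> {X. X \<subseteq> h \<and> card X = R}"
      then have X: "X \<subseteq> h" "card X = R" by simp_all
      obtain x y where "(x, y) \<in> P" "x \<in> X" "y \<in> X" "x \<noteq> y" using hit[OF X] by blast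
      then have "(x, y) \<in> P'" "X \<in> B (x, y)" using X by (simp_all add: P'_def B_def)
      then show "X \<in> (\<Union>p\<in>P'. B p)" by blast
    qed
  qed
  also have "\<dots> \<le> (\<Sum>p\<in>P'. card (B p))" by (rule card_UN_le[OF finP(2)])
  also have "\<dots> \<le> card P' * ((m - 2) choose (R - 2))"
    using sum_bounded_above[of P' "\<lambda>p. card (B p)"] B by simp
  also have "\<dots> \<le> card P * ((m - 2) choose (R - 2))"
    by (intro mult_right_mono card_mono finP) (auto simp: P'_def)
  finally have le: "m choose R \<le> card P * ((m - 2) choose (R - 2))" .
  have "R * (R - 1) * (m choose R) = (R - 1) * (R * (m choose R))" by simp
  also have "\<dots> = m * ((R - 1) * ((m - 1) choose (R - 1)))"
    using R(1) by (subst times_binomial_minus1_eq) simp_all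
  also have "\<dots> = m * ((m - 1) * ((m - 1 - 1) choose (R - 1 - 1)))"
    using R(1) by (subst times_binomial_minus1_eq) simp_all
  finally have "R * (R - 1) * (m choose R) = m * (m - 1) * ((m - 2) choose (R - 2))"
    by (simp add: numeral_2_eq_2)
  then have "m * (m - 1) * ((m - 2) choose (R - 2)) \<le> R * (R - 1) * (card P * ((m - 2) choose (R - 2)))"
    using le by (metis mult_le_mono2)
  moreover have "0 < (m - 2) choose (R - 2)" using R(2) by (simp add: m_def)
  ultimately have "m * (m - 1) \<le> R * (R - 1) * card P"
    by (simp add: mult.assoc[symmetric])
  also have "\<dots> \<le> R\<^sup>2 * card P" by (simp add: power2_eq_square)
  finally have "2 * (m * (m - 1)) \<le> 2 * R\<^sup>2 * card P" by simp
  moreover have "m\<^sup>2 \<le> 2 * (m * (m - 1))"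
  proof -
    have "m * m \<le> m * (2 * (m - 1))" using R m_def by (intro mult_left_mono) auto
    then show ?thesis by (simp add: power2_eq_square mult_ac)
  qed
  ultimately show ?thesis unfolding m_def by linarith
qed

text \<open>If the value at \<open>w\<close> has at most \<open>M\<close> possibilities once the other values are known, then at most a
  fraction \<open>M / card V\<close> of all maps satisfies \<open>P\<close>.\<close>

lemma card_PiE_constrained_coordinate:
  assumes fin: "finite U" "finite V" and w: "w \<in> U"
    and le: "\<And>z. z \<in> PiE (U - {w}) (\<lambda>_. V) \<Longrightarrow> real (card {a \<in> V. P (z(w := a))}) \<le> M"
  shows "real (card {x \<in> PiE U (\<lambda>_. V). P x}) \<le> M * real (card V) ^ (card U - 1)"
proof -
  have finP: "finite (PiE U (\<lambda>_. V))" using fin by (intro finite_PiE) auto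
  have "real (card {x \<in> PiE U (\<lambda>_. V). P x}) = (\<Sum>x\<in>{x \<in> PiE U (\<lambda>_. V). P x}. 1)" by simp
  also have "\<dots> = (\<Sum>x\<in>PiE U (\<lambda>_. V). if P x then 1 else 0)" by (rule sum.inter_filter[OF finP])
  also have "\<dots> = (\<Sum>z\<in>PiE (U - {w}) (\<lambda>_. V). \<Sum>a\<in>V. if P (z(w := a)) then 1 else 0)"
    by (rule sum_PiE_update[OF w])
  also have "\<dots> = (\<Sum>z\<in>PiE (U - {w}) (\<lambda>_. V). real (card {a \<in> V. P (z(w := a))}))"
    using sum.inter_filter[OF fin(2), of "\<lambda>_. 1::real"] by simp
  also have "\<dots> \<le> (\<Sum>z\<in>PiE (U - {w}) (\<lambda>_. V). M)" by (rule sum_mono) (rule le)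
  also have "\<dots> = M * real (card V) ^ (card U - 1)"
    using w fin by (simp add: card_PiE)
  finally show ?thesis .
qed

section \<open>Light pairs\<close>

text \<open>Pairs in no hyperedge at all are excluded, so that each edge of a copy of \<open>F\<close> formed by light pairs has a
  hyperedge that can represent it.\<close>

definition light_pairs :: "'b hgraph \<Rightarrow> nat \<Rightarrow> ('b \<times> 'b) set" where
  "light_pairs H q = {(x, y) \<in> verts H \<times> verts H. x \<noteq> y \<and> 0 < codegree H {x, y} \<and> codegree H {x, y} < q}"

text \<open>Given a homomorphism into the light pairs, choose for every edge of \<open>F\<close> a hyperedge containing its image.
  As \<open>H\<close> is Berge-\<open>F\<close>-free, either the homomorphism is not injective or two edges share
  their hyperedge.  So either two vertices have the same image, or the images of an edge
  \<open>{u, v}\<close> and of a further vertex \<open>w\<close> are in a common hyperedge.  In the second case,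
  the image of \<open>w\<close> is in one of fewer than \<open>q\<close> hyperedges of size at most \<open>s\<close>.\<close>

lemma few_light_homs:
  fixes F :: "'a hgraph" and H :: "'b hgraph"
  assumes F: "graph F" and A: "A \<subseteq> verts F \<times> verts F"
    "\<And>u v. (u, v) \<in> A \<Longrightarrow> {u, v} \<in> edges F"
    "\<And>d. d \<in> edges F \<Longrightarrow> \<exists>u v. (u, v) \<in> A \<and> d = {u, v}"
    and H: "hypergraph H" "Berge_free F H"
    and s: "0 \<le> s" "\<And>h. h \<in> edges H \<Longrightarrow> real (card h) \<le> s"
  shows "real (card {x \<in> PiE (verts F) (\<lambda>_. verts H). \<forall>(u, v)\<in>A. (x u, x v) \<in> light_pairs H q})
    \<le> ((real (card (verts F)))\<^sup>2 + real (card A) * real (card (verts F)) * (real q * s))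
       * real (card (verts H)) ^ (card (verts F) - 1)"
proof -
  define U where "U = verts F"
  define V where "V = verts H"
  define L where "L = light_pairs H q"
  define N where "N = real (card V) ^ (card U - 1)"
  have fin: "finite U" "finite V" using F H by (auto simp: U_def V_def graph_def hypergraph_def)
  have hV: "h \<subseteq> V" if "h \<in> edges H" for h
    using H(1) that by (auto simp: hypergraph_def V_def)
  have finE: "finite (edges H)"
    using H(1) unfolding hypergraph_def by (meson finite_Pow_iff finite_subset)
  have finA: "finite A" using A(1) fin unfolding U_def by (meson finite_SigmaI finite_subset)
  let ?P = "PiE U (\<lambda>_. V)"
  have finP: "finite ?P" using fin by (intro finite_PiE) auto
  define S1 where "S1 p = {x \<in> ?P. x (fst p) = x (snd p)}" for p
  define S2 where "S2 t = {x \<in> ?P. (x (fst (fst t)), x (snd (fst t))) \<in> L \<and>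
      (\<exists>h\<in>edges H. {x (fst (fst t)), x (snd (fst t))} \<subseteq> h \<and> x (snd t) \<in> h)}" for t
  \<comment> \<open>The two kinds of coincidence, each with the vertex \<open>w\<close> whose image is constrained.\<close>
  define T1 where "T1 = {(u, w) \<in> U \<times> U. u \<noteq> w}"
  define T2 where "T2 = {((u, v), w) \<in> A \<times> U. w \<noteq> u \<and> w \<noteq> v}"
  have "{x \<in> ?P. \<forall>(u, v)\<in>A. (x u, x v) \<in> L} \<subseteq> (\<Union>p\<in>T1. S1 p) \<union> (\<Union>t\<in>T2. S2 t)"
  proof (rule subsetI, rule ccontr)
    fix x assume "x \<in> {x \<in> ?P. \<forall>(u, v)\<in>A. (x u, x v) \<in> L}"
    then have x: "x \<in> ?P" and light: "\<And>u v. (u, v) \<in> A \<Longrightarrow> (x u, x v) \<in> L" by auto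
    assume not_bad: "x \<notin> (\<Union>p\<in>T1. S1 p) \<union> (\<Union>t\<in>T2. S2 t)"
    have inj: "inj_on x U"
      unfolding inj_on_def
    proof (intro ballI impI, rule ccontr)
      fix u w assume uw: "u \<in> U" "w \<in> U" "x u = x w" "u \<noteq> w"
      then have "(u, w) \<in> T1" "x \<in> S1 (u, w)" using x by (auto simp: T1_def S1_def)
      then show False using not_bad by blast
    qed
    have "\<exists>h\<in>edges H. x ` d \<subseteq> h" if d: "d \<in> edges F" for d
    proof -
      obtain u v where uv: "(u, v) \<in> A" "d = {u, v}" using A(3)[OF d] by blast
      have "0 < codegree H {x u, x v}" using light[OF uv(1)] by (auto simp: L_def light_pairs_def)
      then show ?thesis using uv(2) by (auto simp: codegree_def card_gt_0_iff)
    qed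
    then obtain f where f: "\<And>d. d \<in> edges F \<Longrightarrow> f d \<in> edges H \<and> x ` d \<subseteq> f d" by metis
    have "inj_on f (edges F)"
      unfolding inj_on_def
    proof (intro ballI impI, rule ccontr)
      fix d d' assume d: "d \<in> edges F" "d' \<in> edges F" "f d = f d'" "d \<noteq> d'"
      obtain u v where uv: "(u, v) \<in> A" "d = {u, v}" using A(3)[OF d(1)] by blast
      have card2: "card d = 2" "card d' = 2" "finite d" "d' \<subseteq> U"
        using F d by (auto simp: graph_def nsets_def U_def)
      \<comment> \<open>An end \<open>w\<close> of \<open>d'\<close> outside \<open>d\<close> is sent into the common
        hyperedge, which also contains the image of \<open>d\<close>.\<close>
      have "\<not> d' \<subseteq> d"
        using card2 d(4) by (metis card_subset_eq)
      then obtain w where w: "w \<in> d'" "w \<noteq> u" "w \<noteq> v" using uv(2) by blast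
      have "((u, v), w) \<in> T2" using uv w card2 by (auto simp: T2_def)
      moreover have "x \<in> S2 ((u, v), w)"
        using x light[OF uv(1)] f[OF d(1)] f[OF d(2)] uv(2) d(3) w(1)
        by (auto simp: S2_def intro!: bexI[of _ "f d"])
      ultimately show False using not_bad by blast
    qed
    then have "\<not> Berge_free F H"
      using not_Berge_free_witness[OF H(1), of x F f] inj x f by (auto simp: U_def V_def)
    then show False using H(2) by simp
  qed
  moreover have finS: "finite (S1 p)" "finite (S2 t)" for p t
    using finP by (auto simp: S1_def S2_def)
  moreover have finT: "finite T1" "finite T2"
    using fin finA by (auto simp: T1_def T2_def intro: finite_subset[of _ "U \<times> U"] finite_subset[of _ "A \<times> U"])
  ultimately have "card {x \<in> ?P. \<forall>(u, v)\<in>A. (x u, x v) \<in> L} \<le> card ((\<Union>p\<in>T1. S1 p) \<union> (\<Union>t\<in>T2. S2 t))"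
    by (intro card_mono) auto
  also have "\<dots> \<le> card (\<Union>p\<in>T1. S1 p) + card (\<Union>t\<in>T2. S2 t)" by (rule card_Un_le)
  also have "\<dots> \<le> (\<Sum>p\<in>T1. card (S1 p)) + (\<Sum>t\<in>T2. card (S2 t))"
    by (intro add_mono card_UN_le finT)
  finally have "real (card {x \<in> ?P. \<forall>(u, v)\<in>A. (x u, x v) \<in> L})
      \<le> (\<Sum>p\<in>T1. real (card (S1 p))) + (\<Sum>t\<in>T2. real (card (S2 t)))"
    unfolding of_nat_sum[symmetric] of_nat_add[symmetric] of_nat_le_iff .
  also have "\<dots> \<le> (real (card U))\<^sup>2 * N + real (card A) * real (card U) * (real q * s * N)"
  proof (rule add_mono)
    have "real (card (S1 p)) \<le> 1 * N" if p: "p \<in> T1" for p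
      unfolding S1_def N_def
    proof (rule card_PiE_constrained_coordinate[OF fin])
      show "snd p \<in> U" using p by (auto simp: T1_def)
      fix z :: "'a \<Rightarrow> 'b"
      have "card {a \<in> V. (z(snd p := a)) (fst p) = (z(snd p := a)) (snd p)} \<le> card {z (fst p)}"
        using p by (intro card_mono) (auto simp: T1_def)
      then show "real (card {a \<in> V. (z(snd p := a)) (fst p) = (z(snd p := a)) (snd p)}) \<le> 1" by simp
    qed
    then have "(\<Sum>p\<in>T1. real (card (S1 p))) \<le> real (card T1) * N"
      using sum_bounded_above[of T1 "\<lambda>p. real (card (S1 p))" N] by simp
    also have "card T1 \<le> card (U \<times> U)"
      using fin by (intro card_mono) (auto simp: T1_def)
    then have "real (card T1) * N \<le> (real (card U))\<^sup>2 * N"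
      by (intro mult_right_mono) (auto simp: N_def card_cartesian_product power2_eq_square simp flip: of_nat_mult)
    finally show "(\<Sum>p\<in>T1. real (card (S1 p))) \<le> (real (card U))\<^sup>2 * N" .
  next
    have "real (card (S2 t)) \<le> real q * s * N" if t: "t \<in> T2" for t
      unfolding S2_def N_def
    proof (rule card_PiE_constrained_coordinate[OF fin])
      obtain u v w where t_eq: "t = ((u, v), w)" by (metis prod.collapse)
      have ne: "w \<noteq> u" "w \<noteq> v" using t t_eq by (auto simp: T2_def)
      show "snd t \<in> U" using t by (auto simp: T2_def)
      fix z :: "'a \<Rightarrow> 'b"
      let ?B = "{a \<in> V. ((z(snd t := a)) (fst (fst t)), (z(snd t := a)) (snd (fst t))) \<in> L \<and>
        (\<exists>h\<in>edges H. {(z(snd t := a)) (fst (fst t)), (z(snd t := a)) (snd (fst t))} \<subseteq> h \<and>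
          (z(snd t := a)) (snd t) \<in> h)}"
      let ?C = "{h \<in> edges H. {z u, z v} \<subseteq> h}"
      show "real (card ?B) \<le> real q * s"
      proof (cases "(z u, z v) \<in> L")
        case True
        have finC: "finite ?C" using finE by simp
        have "card ?B \<le> card (\<Union>h\<in>?C. h)"
        proof (rule card_mono)
          show "finite (\<Union>h\<in>?C. h)"
            using finC hV fin(2) by (auto intro: finite_subset[OF _ fin(2)])
          show "?B \<subseteq> (\<Union>h\<in>?C. h)"
          proof
            fix a assume "a \<in> ?B"
            then obtain h where "h \<in> edges H" "{z u, z v} \<subseteq> h" "a \<in> h"
              using ne by (auto simp: t_eq)
            then show "a \<in> (\<Union>h\<in>?C. h)" by blast
          qed
        qed
        also have "\<dots> \<le> (\<Sum>h\<in>?C. card h)" by (rule card_UN_le[OF finC])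
        finally have "real (card ?B) \<le> (\<Sum>h\<in>?C. real (card h))"
          unfolding of_nat_sum[symmetric] of_nat_le_iff .
        also have "\<dots> \<le> real (card ?C) * s"
          by (rule sum_bounded_above) (use s(2) in auto)
        also have "\<dots> \<le> real q * s"
          using True s(1) by (intro mult_right_mono) (auto simp: L_def light_pairs_def codegree_def)
        finally show ?thesis .
      next
        case False
        then have "?B = {}" using ne by (auto simp: t_eq)
        then have "card ?B = 0" by (metis card.empty)
        then show ?thesis using s(1) by simp
      qed
    qed
    then have "(\<Sum>t\<in>T2. real (card (S2 t))) \<le> real (card T2) * (real q * s * N)"
      by (rule sum_bounded_above)
    also have "card T2 \<le> card (A \<times> U)"
      using fin finA by (intro card_mono) (auto simp: T2_def)
    then have "real (card T2) * (real q * s * N) \<le> real (card A) * real (card U) * (real q * s * N)"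
      using s(1) by (intro mult_right_mono) (auto simp: N_def card_cartesian_product simp flip: of_nat_mult)
    finally show "(\<Sum>t\<in>T2. real (card (S2 t))) \<le> real (card A) * real (card U) * (real q * s * N)" .
  qed
  finally show ?thesis
    by (simp add: U_def V_def L_def N_def algebra_simps)
qed

theorem theorem4:
  fixes F :: "'a hgraph" and e :: "'a set" and g :: "nat \<Rightarrow> real"
  assumes "graph F" and "e \<in> edges F"
    and "g \<in> o[at_top](\<lambda>n. real n)"
  shows "\<forall>\<epsilon>::real. \<epsilon> > 0 \<longrightarrow>
    (\<exists>n0::nat. \<forall>n\<ge>n0. \<forall>H :: 'b hgraph.
       hypergraph H \<and> card (verts H) = n \<and> Berge_free F H \<and>
       (\<forall>h\<in>edges H. ramsey_number F (del_edge F e) \<le> card h \<and> real (card h) \<le> g n)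
       \<longrightarrow> (\<Sum>h\<in>edges H. (real (card h))\<^sup>2) \<le> \<epsilon> * (real n)\<^sup>2)"
proof (intro allI impI)
  fix \<epsilon> :: real assume "0 < \<epsilon>"
  define U where "U = verts F"
  define k where "k = card U"
  define q where "q = card (edges F)"
  define R where "R = ramsey_number F (del_edge F e)"
  have finU: "finite U" using assms(1) by (simp add: U_def graph_def)
  have finE: "finite (edges F)"
    using assms(1) unfolding graph_def by (meson finite_imp_finite_nsets finite_subset)
  have q: "0 < q" using finE assms(2) by (auto simp: q_def card_gt_0_iff)
  have graph': "graph (del_edge F e)" using assms(1) by (auto simp: graph_def del_edge_def)
  have ramsey: "ramsey_prop F (del_edge F e) R"
    unfolding R_def by (rule ramsey_prop_ramsey_number[OF assms(1) graph'])
  have e2: "e \<subseteq> U" "card e = 2" using assms(1,2) by (auto simp: graph_def nsets_def U_def)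
  then have k: "2 \<le> k" unfolding k_def using finU by (metis card_mono)
  \<comment> \<open>A complete graph with the Ramsey property has room for the vertices of \<open>F\<close> under any
    colouring.\<close>
  have "k \<le> R"
  proof -
    have "\<exists>\<phi> :: 'a \<Rightarrow> nat. inj_on \<phi> U \<and> \<phi> ` U \<subseteq> {..<R}"
      by (rule ramsey_prop_on_set[OF ramsey finite_lessThan card_lessThan assms(1) graph', of "\<lambda>_. True"])
        (auto simp: U_def del_edge_def)
    then show ?thesis unfolding k_def by (metis card_inj_on_le card_lessThan finite_lessThan)
  qed
  then have R: "2 \<le> R" using k by simp
  obtain A where A: "A \<subseteq> U \<times> U" "asym A"
    "\<And>u v. (u, v) \<in> A \<Longrightarrow> {u, v} \<in> edges F"
    "\<And>d. d \<in> edges F \<Longrightarrow> \<exists>u v. (u, v) \<in> A \<and> d = {u, v}"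
    unfolding U_def by (rule graph_orientation[OF assms(1)]) blast
  \<comment> \<open>Chosen to absorb the loss of \<open>2 R\<^sup>2\<close> inside each hyperedge and the multiplicity
    \<open>q\<close> of a light pair.\<close>
  define \<epsilon>' where "\<epsilon>' = \<epsilon> / (2 * (real R)\<^sup>2 * real q)"
  have \<epsilon>': "0 < \<epsilon>'" using \<open>0 < \<epsilon>\<close> q R by (simp add: \<epsilon>'_def)
  obtain c where c: "0 < c" and rem: "\<forall>(V :: 'b set) G. finite V \<and> G \<subseteq> V \<times> V \<longrightarrow>
      c * real (card V) ^ card U \<le> real (card {x \<in> PiE U (\<lambda>_. V). \<forall>(s, t)\<in>A. (x s, x t) \<in> G}) \<or>
      (\<exists>D\<subseteq>G. real (card D) \<le> \<epsilon>' * (real (card V))\<^sup>2 \<and>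
        (\<forall>x\<in>PiE U (\<lambda>_. V). \<exists>(s, t)\<in>A. (x s, x t) \<notin> G - D))"
    by (rule removal_lemma[OF finU A(1,2) \<epsilon>'])
  \<comment> \<open>Both terms in the bound of \<open>few_light_homs\<close> are to be at most \<open>c n / 2\<close>:
    the first for large \<open>n\<close>, the second when hyperedges have size at most
    \<open>\<delta> n\<close>.\<close>
  define a where "a = real (card A) * real k * real q"
  define \<delta> where "\<delta> = c / (2 * (a + 1))"
  have a: "0 \<le> a" by (simp add: a_def)
  then have \<delta>: "0 < \<delta>" using c by (simp add: \<delta>_def)
  have "eventually (\<lambda>n. norm (g n) \<le> \<delta> * norm (real n)) at_top"
    using landau_o.smallD[OF assms(3) \<delta>] .
  then obtain n1 where n1: "\<And>n. n1 \<le> n \<Longrightarrow> \<bar>g n\<bar> \<le> \<delta> * real n"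
    by (auto simp: eventually_at_top_linorder)
  obtain n2 :: nat where n2: "2 * (real k)\<^sup>2 / c < real n2" using reals_Archimedean2 by blast
  show "\<exists>n0::nat. \<forall>n\<ge>n0. \<forall>H :: 'b hgraph.
       hypergraph H \<and> card (verts H) = n \<and> Berge_free F H \<and>
       (\<forall>h\<in>edges H. ramsey_number F (del_edge F e) \<le> card h \<and> real (card h) \<le> g n)
       \<longrightarrow> (\<Sum>h\<in>edges H. (real (card h))\<^sup>2) \<le> \<epsilon> * (real n)\<^sup>2"
  proof (intro exI[of _ "max n1 n2"] allI impI)
    fix n and H :: "'b hgraph" assume n: "max n1 n2 \<le> n"
    assume asm: "hypergraph H \<and> card (verts H) = n \<and> Berge_free F H \<and>
       (\<forall>h\<in>edges H. ramsey_number F (del_edge F e) \<le> card h \<and> real (card h) \<le> g n)"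
    then have H: "hypergraph H" "Berge_free F H" and cardV: "card (verts H) = n"
      and hR: "\<And>h. h \<in> edges H \<Longrightarrow> R \<le> card h" and hg: "\<And>h. h \<in> edges H \<Longrightarrow> real (card h) \<le> \<bar>g n\<bar>"
      by (auto simp: R_def)
    define V where "V = verts H"
    define G where "G = light_pairs H q"
    have finV: "finite V" and hV: "\<And>h. h \<in> edges H \<Longrightarrow> h \<subseteq> V"
      using H(1) by (auto simp: hypergraph_def V_def)
    have finH: "finite (edges H)"
      using H(1) unfolding hypergraph_def by (meson finite_Pow_iff finite_subset)
    have GV: "G \<subseteq> V \<times> V" by (auto simp: G_def light_pairs_def V_def)
    have npos: "2 * (real k)\<^sup>2 / c < real n" using n n2 by linarith
    moreover have "0 \<le> 2 * (real k)\<^sup>2 / c" using c by simp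
    ultimately have n0: "0 < real n" by linarith
    have "real (card {x \<in> PiE U (\<lambda>_. V). \<forall>(u, v)\<in>A. (x u, x v) \<in> G}) < c * real n ^ k"
    proof -
      have "real (card {x \<in> PiE U (\<lambda>_. V). \<forall>(u, v)\<in>A. (x u, x v) \<in> G})
          \<le> ((real k)\<^sup>2 + real (card A) * real k * (real q * \<bar>g n\<bar>)) * real n ^ (k - 1)"
        unfolding G_def U_def V_def k_def cardV[symmetric]
        by (rule few_light_homs[OF assms(1) A(1)[unfolded U_def] A(3,4) H]) (use hg cardV in auto)
      also have "\<dots> < (c * real n) * real n ^ (k - 1)"
      proof (rule mult_strict_right_mono)
        have "(real k)\<^sup>2 < c * real n / 2" using npos c by (simp add: field_simps)
        moreover have "a * \<bar>g n\<bar> \<le> a * (\<delta> * real n)"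
          using n1[of n] n a by (intro mult_left_mono) auto
        moreover have "a * \<delta> \<le> c / 2" using a c by (simp add: \<delta>_def field_simps)
        then have "a * \<delta> * real n \<le> c / 2 * real n" by (rule mult_right_mono) simp
        ultimately show "(real k)\<^sup>2 + real (card A) * real k * (real q * \<bar>g n\<bar>) < c * real n"
          by (simp add: a_def mult.assoc)
      qed (use n0 in simp)
      also have "\<dots> = c * real n ^ k"
        using k by (cases k) auto
      finally show ?thesis .
    qed
    then obtain D where D: "D \<subseteq> G" "real (card D) \<le> \<epsilon>' * (real n)\<^sup>2"
        "\<And>x. x \<in> PiE U (\<lambda>_. V) \<Longrightarrow> \<exists>(s, t)\<in>A. (x s, x t) \<notin> G - D"
      using rem[rule_format, of V G] finV GV cardV
      unfolding V_def[symmetric] k_def not_le[symmetric] by blast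
    have finD: "finite D" using D(1) GV finV by (meson finite_SigmaI finite_subset)
    have hit: "\<exists>x y. (x, y) \<in> D \<inter> (h \<times> h) \<and> x \<in> X \<and> y \<in> X \<and> x \<noteq> y"
      if h: "h \<in> edges H" and X: "X \<subseteq> h" "card X = R" for h X
    proof -
      have finX: "finite X" using X(1) hV[OF h] finV by (meson finite_subset)
      show ?thesis
      proof (rule ramsey_prop_on_set[OF ramsey finX X(2) assms(1) graph', of "\<lambda>d. codegree H d < q"])
        fix \<phi> assume \<phi>: "inj_on \<phi> (verts F)" "\<phi> ` verts F \<subseteq> X"
          "\<And>d. d \<in> edges F \<Longrightarrow> codegree H (\<phi> ` d) < q"
        have \<phi>X: "\<phi> u \<in> X" if "u \<in> U" for u using \<phi>(2) that by (auto simp: U_def)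
        have light: "(\<phi> u, \<phi> v) \<in> G \<and> \<phi> u \<noteq> \<phi> v" if uv: "(u, v) \<in> A" for u v
        proof -
          have mem: "u \<in> U" "v \<in> U" "u \<noteq> v" using A(1,2) uv by (auto dest: asymD)
          then have ne: "\<phi> u \<noteq> \<phi> v" using \<phi>(1) by (auto simp: inj_on_def U_def)
          have "h \<in> {h \<in> edges H. {\<phi> u, \<phi> v} \<subseteq> h}" using h X(1) \<phi>X mem by auto
          then have "0 < codegree H {\<phi> u, \<phi> v}"
            unfolding codegree_def using finH by (auto simp: card_gt_0_iff)
          moreover have "codegree H {\<phi> u, \<phi> v} < q" using \<phi>(3)[OF A(3)[OF uv]] by simp
          moreover have "\<phi> u \<in> V" "\<phi> v \<in> V" using \<phi>X mem X(1) hV[OF h] by auto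
          ultimately show ?thesis using ne by (simp add: G_def light_pairs_def V_def)
        qed
        have "restrict \<phi> U \<in> PiE U (\<lambda>_. V)" using \<phi>X X(1) hV[OF h] by auto
        then obtain s t where st: "(s, t) \<in> A" "(restrict \<phi> U s, restrict \<phi> U t) \<notin> G - D"
          using D(3) by blast
        have mem: "s \<in> U" "t \<in> U" using A(1) st(1) by auto
        then have "(\<phi> s, \<phi> t) \<in> D" using st light[OF st(1)] by simp
        then show ?thesis using \<phi>X[OF mem(1)] \<phi>X[OF mem(2)] X(1) light[OF st(1)] by blast
      next
        fix \<phi> assume \<phi>: "inj_on \<phi> (verts (del_edge F e))" "\<phi> ` verts (del_edge F e) \<subseteq> X"
          "\<And>d. d \<in> edges (del_edge F e) \<Longrightarrow> \<not> codegree H (\<phi> ` d) < q"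
        have "\<not> Berge_free F H"
          by (rule heavy_copy_not_Berge_free[OF assms(1,2) H(1) h, of \<phi>])
            (use \<phi> X(1) in \<open>auto simp: del_edge_def q_def not_less\<close>)
        then show ?thesis using H(2) by simp
      qed
    qed
    have per_edge: "(real (card h))\<^sup>2 \<le> 2 * (real R)\<^sup>2 * real (card (D \<inter> (h \<times> h)))"
      if h: "h \<in> edges H" for h
    proof -
      have "finite h" using hV[OF h] finV by (rule finite_subset)
      then have "(card h)\<^sup>2 \<le> 2 * R\<^sup>2 * card (D \<inter> (h \<times> h))"
        by (rule pairs_hitting_all_subsets[OF _ R hR[OF h]]) (use hit[OF h] in auto)
      then have "real ((card h)\<^sup>2) \<le> real (2 * R\<^sup>2 * card (D \<inter> (h \<times> h)))"
        unfolding of_nat_le_iff .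
      then show ?thesis by simp
    qed
    have "(\<Sum>h\<in>edges H. card (D \<inter> (h \<times> h))) = (\<Sum>h\<in>edges H. \<Sum>z\<in>D. of_bool (z \<in> h \<times> h))"
      using finD by (simp add: Int_def)
    also have "\<dots> = (\<Sum>z\<in>D. \<Sum>h\<in>edges H. of_bool (z \<in> h \<times> h))" by (rule sum.swap)
    also have "\<dots> \<le> (\<Sum>z\<in>D. q)"
    proof (rule sum_mono)
      fix z assume "z \<in> D"
      then obtain x y where z: "z = (x, y)" "codegree H {x, y} < q"
        using D(1) by (cases z) (auto simp: G_def light_pairs_def)
      have "(\<Sum>h\<in>edges H. of_bool (z \<in> h \<times> h)) = card {h \<in> edges H. z \<in> h \<times> h}"
        using finH by (simp add: Int_def)
      also have "\<dots> = codegree H {x, y}" by (simp add: codegree_def z(1))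
      finally show "(\<Sum>h\<in>edges H. of_bool (z \<in> h \<times> h)) \<le> q" using z(2) by simp
    qed
    finally have total: "(\<Sum>h\<in>edges H. card (D \<inter> (h \<times> h))) \<le> q * card D" by (simp add: mult.commute)
    have "(\<Sum>h\<in>edges H. (real (card h))\<^sup>2) \<le> (\<Sum>h\<in>edges H. 2 * (real R)\<^sup>2 * real (card (D \<inter> (h \<times> h))))"
      by (rule sum_mono) (rule per_edge)
    also have "\<dots> = 2 * (real R)\<^sup>2 * real (\<Sum>h\<in>edges H. card (D \<inter> (h \<times> h)))"
      by (simp add: sum_distrib_left)
    also have "\<dots> \<le> 2 * (real R)\<^sup>2 * real (q * card D)"
      using total by (intro mult_left_mono) (simp_all only: of_nat_le_iff, simp)
    also have "\<dots> = 2 * (real R)\<^sup>2 * real q * real (card D)" by simp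
    also have "\<dots> \<le> 2 * (real R)\<^sup>2 * real q * (\<epsilon>' * (real n)\<^sup>2)"
      using D(2) by (intro mult_left_mono) simp_all
    also have "\<dots> = \<epsilon> * (real n)\<^sup>2" using q R by (simp add: \<epsilon>'_def)
    finally show "(\<Sum>h\<in>edges H. (real (card h))\<^sup>2) \<le> \<epsilon> * (real n)\<^sup>2" .
  qed
qed

end
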